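(* Let $a=(a_1,a_2,a_3,a_4)\in\mathbb{R}^4$ satisfy $a_i>0$ and $a_i<a_j+a_k+a_l$ for all $i$ (where $\{i,j,k,l\}=\{1,2,3,4\}$). A quadrilateral with the side lengths $a$ is $n$-periodic disregarding the orientation if and only if the following condition is satisfied: $$\begin{vmatrix} A_2 & A_3 & \ldots & A_{k+1} \\ A_3 & A_4 & \ldots & A_{k+2} \\ \vdots & \vdots & \ddots & \vdots \\ A_{k+1} & A_{k+2} & \ldots & A_{2k} \end{vmatrix}=0\quad\text{if }n=2k+1,$$ $$\begin{vmatrix} A_3 & A_4 & \ldots & A_{k+1} \\ A_4 & A_5 & \ldots & A_{k+2} \\ \vdots & \vdots & \ddots & \vdots \\ A_{k+1} & A_{k+2} & \ldots & A_{2k-1} \end{vmatrix}=0\quad\text{if }n=2k.$$ Here $A_i$ are the coefficients of the expansion $$\sqrt{(x-\Delta(a)^2)(x-\delta(a)^2)(x-\delta(\bar a)^2)}=\sum_{i=0}^\infty A_ix^i,$$ where $$\Delta(a)=a_1a_3+a_2a_4,\qquad \delta(a)=a_1a_3-a_2a_4.$$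
   Context: The conjugate quadruple is $\bar a=(\bar a_1,\bar a_2,\bar a_3,\bar a_4)$ with $\bar a_i=\frac{a_1+a_2+a_3+a_4}{2}-a_i$, so that $\delta(\bar a)=\bar a_1\bar a_3-\bar a_2\bar a_4$. A quadrilateral with side lengths $a$ is an ordered quadruple $(A,B,C,D)$ of points in $\mathbb{R}^2$ with $|AB|=a_1$, $|BC|=a_2$, $|CD|=a_3$, $|DA|=a_4$ (sides may cross). The $D$-folding $F_D$ maps $ABCD$ (with $A\ne C$) to $ABCD'$, where $D'$ is the reflection of $D$ in the line $AC$; the $C$-folding $F_C$ maps $ABCD$ (with $B\neq D$) to $ABC'D$, where $C'$ is the reflection of $C$ in the line $BD$. Both preserve the side lengths. The quadrilateral is called $n$-periodic disregarding the orientation if $(F_C\circ F_D)^n(ABCD)$ is congruent to $ABCD$ (respecting the marking of the vertices) by a possibly orientation-reversing isometry of $\mathbb{R}^2$; $n$ is not required to be minimal.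
   Formalization: For a single quadrilateral the "only if" is claimed only if its vertices are not all on one line (collinear ones can be fixed by both foldings with nonzero determinant); the power series expansion is assumed to exist, which fails when exactly one of δ(a), δ(ā) is 0. *)

theory Defs
  imports
    "HOL-Analysis.Analysis"
    "HOL-Computational_Algebra.Formal_Power_Series"
    "Jordan_Normal_Form.Determinant"
begin

no_notation Matrix.vec_index (infixl "$" 100)

text \<open>The index type \<^typ>\<open>4\<close> is arithmetic modulo 4, so \<open>a $ 4\<close> is \<open>a $ 0\<close> and the indices
  1, 2, 3, 4 are pairwise distinct.\<close>

definition admissible_sides :: "real ^ 4 \<Rightarrow> bool" where
  "admissible_sides a \<longleftrightarrow> (\<forall>i. 0 < a $ i \<and> a $ i < (\<Sum>j\<in>UNIV - {i}. a $ j))"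

definition conj_sides :: "real ^ 4 \<Rightarrow> real ^ 4" where
  "conj_sides a = (\<chi> i. (a $ 1 + a $ 2 + a $ 3 + a $ 4) / 2 - a $ i)"

definition Delta_sides :: "real ^ 4 \<Rightarrow> real" where
  "Delta_sides a = a $ 1 * a $ 3 + a $ 2 * a $ 4"

definition delta_sides :: "real ^ 4 \<Rightarrow> real" where
  "delta_sides a = a $ 1 * a $ 3 - a $ 2 * a $ 4"

type_synonym quadrilateral = "(real ^ 2) \<times> (real ^ 2) \<times> (real ^ 2) \<times> (real ^ 2)"

fun has_sides :: "quadrilateral \<Rightarrow> real ^ 4 \<Rightarrow> bool" where
  "has_sides (A, B, C, D) a \<longleftrightarrow>
     dist A B = a $ 1 \<and> dist B C = a $ 2 \<and> dist C D = a $ 3 \<and> dist D A = a $ 4"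

fun collinear_quad :: "quadrilateral \<Rightarrow> bool" where
  "collinear_quad (A, B, C, D) \<longleftrightarrow> collinear {A, B, C, D}"

text \<open>The midpoint of a point and its mirror image is the foot of the perpendicular, that is,
  the point of the line closest to it.\<close>

definition reflect_line :: "real ^ 2 \<Rightarrow> real ^ 2 \<Rightarrow> real ^ 2 \<Rightarrow> real ^ 2" where
  "reflect_line P Q X = 2 *\<^sub>R closest_point (affine hull {P, Q}) X - X"

text \<open>The foldings are partial maps: there is no line to reflect in when the two vertices
  spanning the diagonal coincide.\<close>

fun fold_D :: "quadrilateral \<Rightarrow> quadrilateral option" where
  "fold_D (A, B, C, D) = (if A \<noteq> C then Some (A, B, C, reflect_line A C D) else None)"

fun fold_C :: "quadrilateral \<Rightarrow> quadrilateral option" where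
  "fold_C (A, B, C, D) = (if B \<noteq> D then Some (A, B, reflect_line B D C, D) else None)"

definition fold_CD :: "quadrilateral \<Rightarrow> quadrilateral option" where
  "fold_CD Q = Option.bind (fold_D Q) fold_C"

definition iterate_fold_CD :: "nat \<Rightarrow> quadrilateral \<Rightarrow> quadrilateral option" where
  "iterate_fold_CD n Q = ((\<lambda>q. Option.bind q fold_CD) ^^ n) (Some Q)"

text \<open>Distance-preserving self-maps of the plane are exactly its isometries, orientation-preserving
  or orientation-reversing.\<close>

fun congruent_quad :: "quadrilateral \<Rightarrow> quadrilateral \<Rightarrow> bool" where
  "congruent_quad (A, B, C, D) Q' \<longleftrightarrow>
     (\<exists>f :: real ^ 2 \<Rightarrow> real ^ 2. (\<forall>x y. dist (f x) (f y) = dist x y) \<and> Q' = (f A, f B, f C, f D))"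

definition periodic_disregarding_orientation :: "nat \<Rightarrow> quadrilateral \<Rightarrow> bool" where
  "periodic_disregarding_orientation n Q \<longleftrightarrow>
     (\<exists>Q'. iterate_fold_CD n Q = Some Q' \<and> congruent_quad Q Q')"

text \<open>The radicand is negative at 0, so the expansion has complex coefficients. Its square roots in
  the ring of formal power series differ only by a sign. There is none if exactly one of
  \<open>delta_sides a\<close> and \<open>delta_sides (conj_sides a)\<close> is zero.\<close>

definition radicand :: "real ^ 4 \<Rightarrow> complex fps" where
  "radicand a =
     (fps_X - fps_const (of_real ((Delta_sides a)\<^sup>2))) *
     (fps_X - fps_const (of_real ((delta_sides a)\<^sup>2))) *
     (fps_X - fps_const (of_real ((delta_sides (conj_sides a))\<^sup>2)))"

definition sqrt_expansion :: "real ^ 4 \<Rightarrow> complex fps \<Rightarrow> bool" where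
  "sqrt_expansion a S \<longleftrightarrow> S\<^sup>2 = radicand a"

text \<open>The \<open>m \<times> m\<close> determinant with upper left entry \<open>c s\<close>; it equals 1 for \<open>m = 0\<close>.\<close>

definition hankel_det :: "(nat \<Rightarrow> complex) \<Rightarrow> nat \<Rightarrow> nat \<Rightarrow> complex" where
  "hankel_det c s m = Determinant.det (Matrix.mat m m (\<lambda>(i, j). c (s + i + j)))"

definition period_condition :: "complex fps \<Rightarrow> nat \<Rightarrow> bool" where
  "period_condition S n \<longleftrightarrow>
     (\<forall>k. n = 2 * k + 1 \<longrightarrow> hankel_det (fps_nth S) 2 k = 0) \<and>
     (\<forall>k. n = 2 * k \<longrightarrow> hankel_det (fps_nth S) 3 (k - 1) = 0)"

end

theory Submission
  imports Defs
begin

text \<open>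
  Let \<open>p\<close> and \<open>q\<close> be the squares of the diagonals \<open>AC\<close> and \<open>BD\<close>. Up to congruence a quadrilateral
  is a point of the cubic curve given by the vanishing of the Cayley--Menger determinant, which is
  quadratic in \<open>p\<close> and in \<open>q\<close>; folding \<open>D\<close> exchanges the two roots \<open>q\<close> for given \<open>p\<close>, and folding
  \<open>C\<close> exchanges the two roots \<open>p\<close> for given \<open>q\<close>. Along an orbit \<open>(p\<^sub>j, q\<^sub>j)\<close> put \<open>x\<^sub>j = p\<^sub>j q\<^sub>j\<close> and
  \<open>l\<^sub>j(x) = t + m\<^sub>j x\<close>, where \<open>m\<^sub>j = p\<^sub>j + q\<^sub>j\<^sub>+\<^sub>1 - (a\<^sub>1\<^sup>2 + a\<^sub>2\<^sup>2 + a\<^sub>3\<^sup>2 + a\<^sub>4\<^sup>2) / 2\<close> and \<open>t\<close> is the product of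
  \<open>\<Delta>(a)\<close>, \<open>\<delta>(a)\<close> and \<open>\<delta>\<close> of the conjugate quadruple. Vieta's formulas give
  \<open>g(x) = l\<^sub>j(x)\<^sup>2 - x (x - x\<^sub>j) (x - x\<^sub>j\<^sub>+\<^sub>1)\<close> for every \<open>j\<close>, where \<open>g\<close> is the negated radicand: on the
  curve \<open>y\<^sup>2 = g(x)\<close> the double folding is the translation by the point \<open>(0, t)\<close>.

  If \<open>R\<close> is the square root of \<open>g\<close> with \<open>R(0) = t\<close>, the products of the \<open>(R - l\<^sub>i) / (x - x\<^sub>i)\<close> are,
  up to a factor \<open>x - x\<^sub>0\<close>, of the form \<open>U\<^sub>j + V\<^sub>j R\<close> and divisible by \<open>x\<^sup>j\<close>. After a return to the start
  a common factor \<open>x - x\<^sub>0\<close> cancels from \<open>U\<^sub>n\<close> and \<open>V\<^sub>n\<close>. What remains is a Pade relation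
  \<open>P + Q R = O(x\<^sup>n)\<close> of unusually low degree, whose existence is the vanishing of the Hankel determinant.
  Conversely such a relation is proportional to \<open>U\<^sub>n + V\<^sub>n R\<close>, and comparing norms shows that
  \<open>(x - x\<^sub>0) (x - x\<^sub>n)\<close> is a square.

  If \<open>t = 0\<close>, the existence of the square root forces a kite. Then wherever the double folding is defined
  it ends with \<open>A = C\<close> for one kind of kite and starts with \<open>B = D\<close> for the other, while it needs
  \<open>A \<noteq> C\<close> before and \<open>B \<noteq> D\<close> after the folding of \<open>D\<close>; so nothing is periodic, and the Hankel
  determinant does not vanish.
\<close>

section \<open>Pade relations along a sequence of chords\<close>

lemma fps_X_power_dvd_iff:
  fixes f :: "'a::field fps"
  shows "fps_X ^ n dvd f \<longleftrightarrow> (\<forall>i<n. fps_nth f i = 0)"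
proof (cases "f = 0")
  case False
  hence "fps_X ^ n dvd f \<longleftrightarrow> n \<le> subdegree f"
    by (simp add: fps_dvd_iff fps_X_power_subdegree)
  also have "\<dots> \<longleftrightarrow> (\<forall>i<n. fps_nth f i = 0)"
    using False by (auto intro: subdegree_geI nth_less_subdegree_zero)
  finally show ?thesis .
qed simp

lemma poly_eq_monom_if_fps_X_power_dvd:
  fixes p :: "'a::field poly"
  assumes "fps_X ^ n dvd fps_of_poly p" and "degree p \<le> n"
  shows "p = monom (coeff p n) n"
proof (rule poly_eqI)
  fix i
  show "coeff p i = coeff (monom (coeff p n) n) i"
    using assms by (cases i n rule: linorder_cases) (auto simp: fps_X_power_dvd_iff coeff_eq_0)
qed

text \<open>For \<open>n \<ge> 1\<close>, \<open>P\<close> and \<open>Q\<close> together have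
  \<open>n\<close> free coefficients under \<open>n\<close> linear conditions, so a nonzero solution
  is exceptional.\<close>

definition pade_relation :: "nat \<Rightarrow> 'a::field fps \<Rightarrow> 'a poly \<Rightarrow> 'a poly \<Rightarrow> bool" where
  "pade_relation n S P Q \<longleftrightarrow> Q \<noteq> 0 \<and> degree Q < (n - 1) div 2 \<and> degree P \<le> n div 2 \<and>
     fps_X ^ n dvd fps_of_poly P + fps_of_poly Q * S"

text \<open>The norm factors as \<open>(P + Q * S) * (P - Q * S)\<close>, so \<open>X ^ n\<close>
  divides it, while the two degree bounds cap its degree at \<open>n\<close>.\<close>

lemma pade_norm:
  fixes S :: "'a::field fps"
  assumes "pade_relation n S P Q" and "S\<^sup>2 = fps_of_poly g" and "degree g = 3"
  shows "P\<^sup>2 - Q\<^sup>2 * g = monom (coeff (P\<^sup>2 - Q\<^sup>2 * g) n) n"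
proof (rule poly_eq_monom_if_fps_X_power_dvd)
  have "fps_of_poly (P\<^sup>2 - Q\<^sup>2 * g) =
      (fps_of_poly P + fps_of_poly Q * S) * (fps_of_poly P - fps_of_poly Q * S)"
    by (simp add: fps_of_poly_diff fps_of_poly_mult fps_of_poly_power flip: assms(2))
      (simp add: algebra_simps power2_eq_square)
  thus "fps_X ^ n dvd fps_of_poly (P\<^sup>2 - Q\<^sup>2 * g)"
    using assms(1) by (simp add: pade_relation_def)
  have "degree (P\<^sup>2) \<le> n"
    using assms(1) degree_power_le[of P 2] by (auto simp: pade_relation_def)
  moreover have "degree (Q\<^sup>2 * g) \<le> n"
    using assms degree_power_le[of Q 2] degree_mult_le[of "Q\<^sup>2" g]
    by (auto simp: pade_relation_def)
  ultimately show "degree (P\<^sup>2 - Q\<^sup>2 * g) \<le> n"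
    by (rule degree_diff_le)
qed

text \<open>The line \<open>y = t + m\<^sub>j x\<close> meets the curve \<open>y\<^sup>2 = g(x)\<close> in points with abscissae \<open>0\<close>, \<open>x\<^sub>j\<close> and
  \<open>x\<^sub>j\<^sub>+\<^sub>1\<close>; by \<open>join\<close> consecutive lines meet the curve over \<open>x\<^sub>j\<^sub>+\<^sub>1\<close> in opposite points.\<close>

locale chord_sequence =
  fixes g :: "'a::field_char_0 poly" and R :: "'a fps" and t :: 'a and x m :: "nat \<Rightarrow> 'a"
  assumes R_square: "R\<^sup>2 = fps_of_poly g"
    and R_0: "fps_nth R 0 = t"
    and t_nz: "t \<noteq> 0"
    and x_nz: "x j \<noteq> 0"
    and chord: "g = [:t, m j:]\<^sup>2 - [:0, 1:] * [:- x j, 1:] * [:- x (Suc j), 1:]"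
    and join: "2 * t + (m j + m (Suc j)) * x (Suc j) = 0"
begin

definition slope_sum :: "nat \<Rightarrow> 'a" where
  "slope_sum j = m j + m (Suc j)"

text \<open>Write \<open>l j\<close> for the line of index \<open>j\<close>. Then
  \<open>U j + V j * R\<close> stands for \<open>X - x 0\<close> times the product of
  \<open>(R - l i) / (X - x i)\<close> over \<open>i < j\<close>. Since
  \<open>l j + l (j + 1) = slope_sum j * (X - x (j + 1))\<close>, these products obey a three-term
  recursion, which keeps \<open>U\<close> and \<open>V\<close> polynomial.\<close>

fun U :: "nat \<Rightarrow> 'a poly" where
  "U 0 = [:- x 0, 1:]"
| "U (Suc 0) = - [:t, m 0:]"
| "U (Suc (Suc j)) = - [:0, 1:] * U j - [:slope_sum j:] * U (Suc j)"

fun V :: "nat \<Rightarrow> 'a poly" where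
  "V 0 = 0"
| "V (Suc 0) = 1"
| "V (Suc (Suc j)) = - [:0, 1:] * V j - [:slope_sum j:] * V (Suc j)"

lemma line_sum: "[:t, m j:] + [:t, m (Suc j):] = [:slope_sum j:] * [:- x (Suc j), 1:]"
  using join[of j] by (simp add: slope_sum_def algebra_simps eq_neg_iff_add_eq_0)

text \<open>The chords \<open>j\<close> and \<open>j + 1\<close> both express \<open>g\<close>.
  Subtracting them gives a difference of squares, from which the shared factor
  \<open>X - x (j + 1)\<close> cancels.\<close>

lemma line_diff:
  "[:slope_sum j:] * ([:t, m (Suc j):] - [:t, m j:]) = [:0, 1:] * [:x j - x (Suc (Suc j)):]"
proof -
  let ?a = "[:t, m j:]" and ?b = "[:t, m (Suc j):]" and ?w = "[:- x (Suc j), 1:]"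
  have "?w * ([:slope_sum j:] * (?b - ?a)) = (?a + ?b) * (?b - ?a)"
    by (simp only: line_sum ac_simps)
  also have "\<dots> = ?b\<^sup>2 - ?a\<^sup>2"
    by (simp only: power2_eq_square ring_distribs ac_simps) (simp only: algebra_simps)
  also have "?b\<^sup>2 = g + [:0, 1:] * ?w * [:- x (Suc (Suc j)), 1:]"
    by (subst chord[of "Suc j"]) (simp only: algebra_simps)
  also have "?a\<^sup>2 = g + [:0, 1:] * [:- x j, 1:] * ?w"
    by (subst chord[of j]) (simp only: algebra_simps)
  also have "g + [:0, 1:] * ?w * [:- x (Suc (Suc j)), 1:] - (g + [:0, 1:] * [:- x j, 1:] * ?w)
      = ?w * ([:0, 1:] * ([:- x (Suc (Suc j)), 1:] - [:- x j, 1:]))"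
    by (simp only: algebra_simps)
  also have "[:- x (Suc (Suc j)), 1:] - [:- x j, 1:] = [:x j - x (Suc (Suc j)):]"
    by simp
  finally show ?thesis
    by (subst (asm) mult_cancel_left) auto
qed

text \<open>For \<open>W j = U j + V j * R\<close> this is the step
  \<open>(X - x j) * W (j + 1) = W j * (R - l j)\<close>, split by powers of \<open>R\<close>, with
  \<open>X - x j\<close> already cancelled in the first equation.\<close>

lemma convergents:
  "U (Suc j) + V (Suc j) * [:t, m j:] = - [:0, 1:] * [:- x (Suc j), 1:] * V j \<and>
   [:- x j, 1:] * V (Suc j) = U j - V j * [:t, m j:]"
proof (induction j)
  case 0
  show ?case by simp
next
  case (Suc j)
  let ?X = "[:0, 1:] :: 'a poly" and ?c = "[:slope_sum j:]"
  let ?a = "[:t, m j:]" and ?b = "[:t, m (Suc j):]"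
  let ?u = "[:- x j, 1:]" and ?w = "[:- x (Suc j), 1:]" and ?v = "[:- x (Suc (Suc j)), 1:]"
  define Vj Vs Uj Us Vss Uss where defs: "Vj = V j" "Vs = V (Suc j)" "Uj = U j" "Us = U (Suc j)"
    "Vss = V (Suc (Suc j))" "Uss = U (Suc (Suc j))"
  have IH: "Us = - ?X * ?w * Vj - Vs * ?a" "Uj = ?u * Vs + Vj * ?a"
    using Suc by (simp_all only: defs eq_diff_eq diff_add_cancel)
  have rec: "Vss = - ?X * Vj - ?c * Vs" "Uss = - ?X * Uj - ?c * Us"
    unfolding defs by simp_all
  have b: "?b = ?c * ?w - ?a" using line_sum[of j] by (metis add_diff_cancel_left')
  have d: "?c * (?b - ?a) = ?X * (?u - ?v) * (-1)"
    unfolding line_diff by simp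
  have 1: "?w * Vss = Us - Vs * ?b"
    unfolding rec IH b by (simp only: algebra_simps)
  have "Uss + Vss * ?b = - ?X * (Uj + Vj * ?b) - ?c * (Us + Vs * ?b)"
    unfolding rec by (simp only: algebra_simps)
  also have "Uj + Vj * ?b = ?u * Vs + Vj * ?c * ?w"
    unfolding IH b by (simp only: algebra_simps)
  also have "Us + Vs * ?b = - ?X * ?w * Vj + Vs * (?b - ?a)"
    unfolding IH by (simp only: algebra_simps)
  also have "- ?X * (?u * Vs + Vj * ?c * ?w) - ?c * (- ?X * ?w * Vj + Vs * (?b - ?a))
     = - ?X * ?u * Vs - Vs * (?c * (?b - ?a))"
    by (simp only: algebra_simps)
  also have "\<dots> = - ?X * ?v * Vs"
    unfolding d by (simp only: algebra_simps mult_minus_left mult_minus_right mult_1_left)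
  finally show ?case using 1 unfolding defs by blast
qed

lemma convergent_denom: "[:- x j, 1:] * V (Suc j) = U j - V j * [:t, m j:]"
  using convergents[of j] by blast

lemma convergent_numer: "[:- x j, 1:] * U (Suc j) = V j * g - U j * [:t, m j:]"
proof -
  let ?w = "[:- x j, 1:]" and ?a = "[:t, m j:]"
  have expand: "- (y\<^sup>2 - g) * v - (u - v * y) * y = v * g - u * y" for u v y :: "'a poly"
    by (simp add: algebra_simps power2_eq_square)
  have "?w * U (Suc j) = ?w * (- [:0, 1:] * [:- x (Suc j), 1:] * V j - V (Suc j) * ?a)"
    using conjunct1[OF convergents[of j]] by (simp only: flip: eq_diff_eq)
  also have "\<dots> = - ([:0, 1:] * ?w * [:- x (Suc j), 1:]) * V j - ?w * V (Suc j) * ?a"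
    by (simp only: algebra_simps mult_minus_left mult_minus_right)
  also have "[:0, 1:] * ?w * [:- x (Suc j), 1:] = ?a\<^sup>2 - g"
    by (subst chord[of j]) (simp only: algebra_simps)
  also have "- (?a\<^sup>2 - g) * V j - ?w * V (Suc j) * ?a = V j * g - U j * ?a"
    unfolding convergent_denom by (rule expand)
  finally show ?thesis .
qed

text \<open>Norms multiply: \<open>R - l j\<close> has norm
  \<open>X * (X - x j) * (X - x (j + 1))\<close>, and division by \<open>(X - x j) ^ 2\<close> makes
  the product telescope.\<close>

lemma convergent_norm: "(U j)\<^sup>2 - (V j)\<^sup>2 * g = [:0, 1:] ^ j * [:- x 0, 1:] * [:- x j, 1:]"
proof (induction j)
  case 0
  show ?case by (simp add: power2_eq_square)
next
  case (Suc j)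
  let ?w = "[:- x j, 1:]" and ?a = "[:t, m j:]"
  have "?w\<^sup>2 * ((U (Suc j))\<^sup>2 - (V (Suc j))\<^sup>2 * g) = (?w * U (Suc j))\<^sup>2 - (?w * V (Suc j))\<^sup>2 * g"
    by (simp only: algebra_simps power_mult_distrib)
  also have "\<dots> = ((U j)\<^sup>2 - (V j)\<^sup>2 * g) * (?a\<^sup>2 - g)"
    unfolding convergent_denom convergent_numer
    by (simp only: algebra_simps power2_eq_square)
  also have "?a\<^sup>2 - g = [:0, 1:] * ?w * [:- x (Suc j), 1:]"
    by (subst chord[of j]) (simp only: algebra_simps)
  also have "((U j)\<^sup>2 - (V j)\<^sup>2 * g) * ([:0, 1:] * ?w * [:- x (Suc j), 1:]) =
      ?w\<^sup>2 * ([:0, 1:] ^ Suc j * [:- x 0, 1:] * [:- x (Suc j), 1:])"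
    unfolding Suc by (simp only: power_Suc power2_eq_square ac_simps)
  finally show ?case
    by (subst (asm) mult_cancel_left) auto
qed

text \<open>Each factor \<open>R - l i\<close> has constant term \<open>t - t = 0\<close>, and the
  denominators \<open>X - x i\<close> are units because \<open>x i \<noteq> 0\<close>.\<close>

lemma fps_X_power_dvd_convergent:
  "fps_X ^ j dvd fps_of_poly (U j) + fps_of_poly (V j) * R"
proof (induction j)
  case 0
  show ?case by simp
next
  case (Suc j)
  let ?w = "fps_of_poly [:- x j, 1:]" and ?a = "fps_of_poly [:t, m j:]"
  have "?w * (fps_of_poly (U (Suc j)) + fps_of_poly (V (Suc j)) * R)
      = fps_of_poly ([:- x j, 1:] * U (Suc j)) + fps_of_poly ([:- x j, 1:] * V (Suc j)) * R"
    by (simp only: fps_of_poly_mult algebra_simps)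
  also have "\<dots> = fps_of_poly (V j) * R\<^sup>2 - fps_of_poly (U j) * ?a
      + (fps_of_poly (U j) - fps_of_poly (V j) * ?a) * R"
    by (simp only: convergent_denom convergent_numer fps_of_poly_mult fps_of_poly_diff R_square)
  also have "\<dots> = (fps_of_poly (U j) + fps_of_poly (V j) * R) * (R - ?a)"
    by (simp only: algebra_simps power2_eq_square)
  finally have *: "?w * (fps_of_poly (U (Suc j)) + fps_of_poly (V (Suc j)) * R) = \<dots>" .
  have "fps_nth (R - ?a) 0 = 0"
    using R_0 by simp
  hence "fps_X dvd R - ?a"
    using fps_X_power_dvd_iff[of 1 "R - ?a"] by simp
  hence "fps_X ^ Suc j dvd ?w * (fps_of_poly (U (Suc j)) + fps_of_poly (V (Suc j)) * R)"
    unfolding * power_Suc2 by (rule mult_dvd_mono[OF Suc])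
  moreover have "is_unit ?w"
    using x_nz[of j] by (simp add: fps_is_unit_iff)
  ultimately show ?case
    by (simp add: dvd_mult_unit_iff')
qed

text \<open>The expression evaluates \<open>U j + V j * R\<close> at the curve point over
  \<open>x 0\<close> on the line of index 0. It is zero for the two initial values, and the
  recursion is linear.\<close>

lemma convergent_vanishes: "poly (U j) (x 0) + poly (V j) (x 0) * (t + m 0 * x 0) = 0"
proof (induction j rule: U.induct)
  case (3 j)
  have "poly (U (Suc (Suc j))) (x 0) + poly (V (Suc (Suc j))) (x 0) * (t + m 0 * x 0) =
    - x 0 * (poly (U j) (x 0) + poly (V j) (x 0) * (t + m 0 * x 0))
    - slope_sum j * (poly (U (Suc j)) (x 0) + poly (V (Suc j)) (x 0) * (t + m 0 * x 0))"
    by (simp add: algebra_simps)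
  thus ?case using 3 by simp
qed (simp_all add: algebra_simps)

lemma degree_U: "degree (U j) \<le> j div 2 + 1"
proof (induction j rule: U.induct)
  case (3 j)
  have "degree ([:0, 1:] * U j) \<le> 1 + degree (U j)"
    by (rule degree_mult_le[THEN order_trans]) simp
  moreover have "degree ([:slope_sum j:] * U (Suc j)) \<le> degree (U (Suc j))"
    by (rule degree_mult_le[THEN order_trans]) simp
  ultimately show ?case
    using 3 by (auto intro!: degree_diff_le)
qed auto

lemma degree_V: "degree (V j) \<le> (j - 1) div 2"
proof (induction j rule: V.induct)
  case (3 j)
  \<comment> \<open>For \<open>j = 0\<close> the truncated bound alone would give degree 1, one too
    many; there \<open>V 0 = 0\<close> helps.\<close>
  have "degree ([:0, 1:] * V j) \<le> 1 + (j - 1) div 2 \<and> (j = 0 \<longrightarrow> degree ([:0, 1:] * V j) = 0)"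
    using degree_mult_le[of "[:0, 1:]" "V j"] 3 by auto
  hence "degree ([:0, 1:] * V j) \<le> Suc j div 2"
    by (cases j) auto
  moreover have "degree ([:slope_sum j:] * V (Suc j)) \<le> degree (V (Suc j))"
    by (rule degree_mult_le[THEN order_trans]) simp
  ultimately show ?case
    using 3 by (auto intro!: degree_diff_le)
qed auto

text \<open>At 0 the recursion merely multiplies by \<open>- slope_sum j\<close>, which is nonzero
  by \<open>join\<close> and \<open>t \<noteq> 0\<close>. Hence \<open>V n\<close> is a nonzero
  polynomial for \<open>n \<ge> 1\<close>.\<close>

lemma V_at_0: "poly (V (Suc j)) 0 \<noteq> 0"
proof (induction j)
  case (Suc j)
  have "slope_sum j \<noteq> 0"
    using join[of j] t_nz by (auto simp: slope_sum_def)
  thus ?case using Suc by simp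
qed simp

lemma degree_g: "degree g = 3"
proof -
  let ?c = "[:0, 1:] * [:- x 0, 1:] * [:- x (Suc 0), 1:]"
  have "degree ?c = 3"
    by (simp add: degree_mult_eq)
  moreover have "degree ([:t, m 0:]\<^sup>2) < 3"
    using degree_power_le[of "[:t, m 0:]" 2] by (auto split: if_splits)
  ultimately have "degree ([:t, m 0:]\<^sup>2 + - ?c) = 3"
    by (subst degree_add_eq_right) auto
  moreover have "g = [:t, m 0:]\<^sup>2 + - ?c"
    using chord[of 0] by (simp only: diff_conv_add_uminus)
  ultimately show ?thesis by (simp only:)
qed

section \<open>Pade relations and returning chord sequences\<close>

lemma pade_imp_return:
  assumes "pade_relation n R P Q"
  shows "x n = x 0"
proof (rule ccontr)
  assume ne: "x n \<noteq> x 0"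
  have Q: "Q \<noteq> 0" and dQ: "degree Q < (n - 1) div 2" and dP: "degree P \<le> n div 2"
    and dvd: "fps_X ^ n dvd fps_of_poly P + fps_of_poly Q * R"
    using assms by (auto simp: pade_relation_def)
  \<comment> \<open>Eliminating \<open>R\<close> from the two relations leaves a polynomial
    divisible by \<open>X ^ n\<close> but of degree below \<open>n\<close>; so the relations are
    proportional.\<close>
  have "V n * P - U n * Q = 0"
  proof -
    let ?D = "V n * P - U n * Q"
    have "fps_of_poly ?D = fps_of_poly (V n) * (fps_of_poly P + fps_of_poly Q * R)
        - fps_of_poly Q * (fps_of_poly (U n) + fps_of_poly (V n) * R)"
      by (simp add: fps_of_poly_diff fps_of_poly_mult algebra_simps)
    hence "fps_X ^ n dvd fps_of_poly ?D"
      using dvd fps_X_power_dvd_convergent[of n] by (simp add: dvd_diff)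
    moreover have "degree (V n * P) < n" "degree (U n * Q) < n"
      using degree_mult_le[of "V n" P] degree_mult_le[of "U n" Q] degree_U[of n] degree_V[of n] dP dQ
      by auto
    hence "degree ?D < n"
      by (rule degree_diff_less)
    ultimately show ?thesis
      using poly_eq_monom_if_fps_X_power_dvd[of n ?D] coeff_eq_0[of ?D n] by (metis monom_eq_0 less_imp_le)
  qed
  hence eq: "Q * U n = V n * P" by (simp add: mult.commute)
  obtain c where c: "P\<^sup>2 - Q\<^sup>2 * g = monom c n"
    using pade_norm[OF assms R_square degree_g] by blast
  let ?X = "[:0, 1:] :: 'a poly"
  have "?X ^ n * (Q\<^sup>2 * [:- x 0, 1:] * [:- x n, 1:]) = Q\<^sup>2 * ((U n)\<^sup>2 - (V n)\<^sup>2 * g)"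
    unfolding convergent_norm by (simp only: ac_simps)
  also have "\<dots> = (Q * U n)\<^sup>2 - Q\<^sup>2 * (V n)\<^sup>2 * g"
    by (simp only: algebra_simps power_mult_distrib)
  also have "\<dots> = (V n)\<^sup>2 * (P\<^sup>2 - Q\<^sup>2 * g)"
    unfolding eq by (simp only: algebra_simps power_mult_distrib)
  also have "\<dots> = ?X ^ n * (Polynomial.smult c ((V n)\<^sup>2))"
    unfolding c monom_altdef by (simp add: mult.commute)
  finally have *: "Q\<^sup>2 * [:- x 0, 1:] * [:- x n, 1:] = Polynomial.smult c ((V n)\<^sup>2)"
    by (subst (asm) mult_cancel_left) auto
  have nz: "Q\<^sup>2 * [:- x 0, 1:] * [:- x n, 1:] \<noteq> 0"
    using Q by (simp only: mult_eq_0_iff power_eq_0_iff) auto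
  \<comment> \<open>Parity argument: if \<open>x n \<noteq> x 0\<close>, the root \<open>x 0\<close>
    has odd multiplicity on the left of the norm identity and even multiplicity on the
    right.\<close>
  have "order (x 0) (Q\<^sup>2 * [:- x 0, 1:] * [:- x n, 1:]) = 2 * order (x 0) Q + 1"
  proof -
    have "order (x 0) (Q\<^sup>2 * [:- x 0, 1:] * [:- x n, 1:]) =
        order (x 0) (Q\<^sup>2) + order (x 0) [:- x 0, 1:] + order (x 0) [:- x n, 1:]"
      using nz by (metis order_mult mult_eq_0_iff)
    moreover have "order (x 0) (Q\<^sup>2) = 2 * order (x 0) Q"
      using Q by (simp add: power2_eq_square order_mult)
    moreover have "order (x 0) [:- x 0, 1:] = 1"
      using order_power_n_n[of "x 0" 1] by simp
    moreover have "order (x 0) [:- x n, 1:] = 0"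
      using ne by (intro order_0I) simp
    ultimately show ?thesis by simp
  qed
  moreover have "order (x 0) (Polynomial.smult c ((V n)\<^sup>2)) = 2 * order (x 0) (V n)"
  proof -
    have "c \<noteq> 0" "V n \<noteq> 0" using nz unfolding * by auto
    thus ?thesis by (simp add: order_smult power2_eq_square order_mult)
  qed
  ultimately have "2 * order (x 0) Q + 1 = 2 * order (x 0) (V n)"
    unfolding * by simp
  thus False by presburger
qed

text \<open>At \<open>x 0\<close>, \<open>convergent_denom\<close> for index \<open>n\<close> and
  \<open>convergent_vanishes\<close> express \<open>U n\<close> by \<open>V n\<close> with opposite
  signs. As the ordinate \<open>t + m 0 * x 0\<close> is nonzero, both vanish there, and cancelling
  \<open>X - x 0\<close> lowers their degrees as required.\<close>

lemma return_imp_pade: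
  assumes "n \<ge> 1" and "x n = x 0" and "m n = m 0" and nz: "t + m 0 * x 0 \<noteq> 0"
  shows "\<exists>P Q. pade_relation n R P Q"
proof -
  have "0 = poly ([:- x n, 1:] * V (Suc n)) (x n)" by simp
  also have "\<dots> = poly (U n) (x 0) - poly (V n) (x 0) * (t + m 0 * x 0)"
    unfolding convergent_denom using assms by (simp add: algebra_simps)
  finally have "poly (U n) (x 0) = poly (V n) (x 0) * (t + m 0 * x 0)" by simp
  with convergent_vanishes[of n] nz have "poly (U n) (x 0) = 0" "poly (V n) (x 0) = 0"
    by auto
  then obtain P Q where P: "U n = [:- x 0, 1:] * P" and Q: "V n = [:- x 0, 1:] * Q"
    unfolding poly_eq_0_iff_dvd by (auto elim!: dvdE)
  have "V n \<noteq> 0"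
    using V_at_0[of "n - 1"] assms(1) by auto
  hence "Q \<noteq> 0" using Q by auto
  moreover from this have "degree Q < (n - 1) div 2"
    using degree_V[of n] unfolding Q by (subst (asm) degree_mult_eq) auto
  moreover have "degree P \<le> n div 2"
    using degree_U[of n] unfolding P by (cases "P = 0") (auto simp: degree_mult_eq simp del: mult_pCons_left)
  moreover have "fps_X ^ n dvd fps_of_poly P + fps_of_poly Q * R"
  proof -
    have "fps_of_poly (U n) + fps_of_poly (V n) * R =
        fps_of_poly [:- x 0, 1:] * (fps_of_poly P + fps_of_poly Q * R)"
      unfolding P Q by (simp only: fps_of_poly_mult algebra_simps)
    moreover have "is_unit (fps_of_poly [:- x 0, 1:])"
      using x_nz[of 0] by (simp add: fps_is_unit_iff)
    ultimately show ?thesis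
      using fps_X_power_dvd_convergent[of n] by (simp add: dvd_mult_unit_iff')
  qed
  ultimately show ?thesis
    unfolding pade_relation_def by blast
qed

lemma shift: "chord_sequence g R t (\<lambda>j. x (j + i)) (\<lambda>j. m (j + i))"
  using R_square R_0 t_nz x_nz chord join by unfold_locales auto

end

section \<open>Hankel determinants\<close>

lemma hankel_det_eq_0_iff:
  "hankel_det c s m = 0 \<longleftrightarrow>
     (\<exists>v. (\<exists>j<m. v j \<noteq> 0) \<and> (\<forall>i<m. (\<Sum>j<m. c (s + i + j) * v j) = 0))"
proof -
  let ?A = "Matrix.mat m m (\<lambda>(i, j). c (s + i + j))"
  have prod: "?A *\<^sub>v v = 0\<^sub>v m \<longleftrightarrow> (\<forall>i<m. (\<Sum>j<m. c (s + i + j) * Matrix.vec_index v j) = 0)"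
    if "v \<in> carrier_vec m" for v
    using that
    by (auto simp: Matrix.vec_eq_iff scalar_prod_def atLeast0LessThan)
  have "hankel_det c s m = 0 \<longleftrightarrow> (\<exists>v. v \<in> carrier_vec m \<and> v \<noteq> 0\<^sub>v m \<and> ?A *\<^sub>v v = 0\<^sub>v m)"
    unfolding hankel_det_def by (rule det_0_iff_vec_prod_zero) simp
  also have "\<dots> \<longleftrightarrow> (\<exists>v. (\<exists>j<m. v j \<noteq> 0) \<and> (\<forall>i<m. (\<Sum>j<m. c (s + i + j) * v j) = 0))"
  proof safe
    fix v assume v: "v \<in> carrier_vec m" "v \<noteq> 0\<^sub>v m" "?A *\<^sub>v v = 0\<^sub>v m"
    from v(1,2) have "\<exists>j<m. Matrix.vec_index v j \<noteq> 0"
      by (auto simp: Matrix.vec_eq_iff)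
    with v prod show "\<exists>v. (\<exists>j<m. v j \<noteq> 0) \<and> (\<forall>i<m. (\<Sum>j<m. c (s + i + j) * v j) = 0)"
      by blast
  next
    fix v :: "nat \<Rightarrow> complex" and j
    assume v: "j < m" "v j \<noteq> 0" "\<forall>i<m. (\<Sum>j<m. c (s + i + j) * v j) = 0"
    have "Matrix.vec m v \<noteq> 0\<^sub>v m"
      using v(1,2) by (metis index_vec index_zero_vec(1))
    with v(3) show "\<exists>v. v \<in> carrier_vec m \<and> v \<noteq> 0\<^sub>v m \<and> ?A *\<^sub>v v = 0\<^sub>v m"
      by (intro exI[of _ "Matrix.vec m v"]) (simp add: prod)
  qed
  finally show ?thesis .
qed

text \<open>One formula for both parities: the upper left index is 2 for odd and 3 for even
  \<open>n\<close>.\<close>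

lemma period_condition_iff_hankel_det:
  assumes "n \<ge> 1"
  shows "period_condition S n \<longleftrightarrow>
    hankel_det (fps_nth S) (n div 2 + 2 - (n - 1) div 2) ((n - 1) div 2) = 0"
proof (cases "even n")
  case True
  then obtain k where "n = 2 * k" by blast
  moreover from this assms have "(2 * k - 1) div 2 = k - 1" "k + 2 - (k - 1) = 3" by auto
  ultimately show ?thesis by (auto simp: period_condition_def)
next
  case False
  then obtain k where "n = 2 * k + 1" by (rule oddE)
  thus ?thesis by (auto simp: period_condition_def) presburger
qed

text \<open>\<open>P\<close> can absorb every coefficient up to \<open>k\<close>, so only those
  strictly between \<open>k\<close> and \<open>n\<close> constrain \<open>F\<close>.\<close>

lemma ex_poly_cancels_iff:
  fixes F :: "'a::field fps"
  shows "(\<exists>P. degree P \<le> k \<and> fps_X ^ n dvd fps_of_poly P + F) \<longleftrightarrow>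
    (\<forall>i. k < i \<and> i < n \<longrightarrow> fps_nth F i = 0)"
proof safe
  fix P i assume "degree P \<le> k" "fps_X ^ n dvd fps_of_poly P + F" "k < i" "i < n"
  thus "fps_nth F i = 0"
    by (auto simp: fps_X_power_dvd_iff coeff_eq_0)
next
  assume F: "\<forall>i. k < i \<and> i < n \<longrightarrow> fps_nth F i = 0"
  let ?P = "truncate_fps (Suc k) (- F)"
  have "degree ?P \<le> k"
    by (rule degree_le) auto
  moreover have "fps_X ^ n dvd fps_of_poly ?P + F"
    using F by (auto simp: fps_X_power_dvd_iff not_less_eq)
  ultimately show "\<exists>P. degree P \<le> k \<and> fps_X ^ n dvd fps_of_poly P + F"
    by blast
qed

text \<open>Eliminating \<open>P\<close> leaves \<open>N\<close> linear conditions on the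
  \<open>N\<close> coefficients of \<open>Q\<close>. Their matrix is the Hankel matrix once the
  coefficients of \<open>Q\<close> are read from the top down.\<close>

lemma period_condition_iff_pade:
  assumes "n \<ge> 1"
  shows "period_condition S n \<longleftrightarrow> (\<exists>P Q. pade_relation n S P Q)"
proof -
  define N where "N = (n - 1) div 2"
  define k where "k = n div 2"
  have n: "n = k + 1 + N" and N: "N \<le> k" using assms by (auto simp: N_def k_def)
  have nth: "fps_nth (fps_of_poly Q * S) (k + 1 + i) =
      (\<Sum>j<N. fps_nth S (k + 2 - N + i + j) * coeff Q (N - Suc j))" if "degree Q < N" for Q i
  proof -
    have "fps_nth (fps_of_poly Q * S) (k + 1 + i) =
        (\<Sum>l=0..k + 1 + i. coeff Q l * fps_nth S (k + 1 + i - l))"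
      by (simp add: fps_mult_nth)
    also have "\<dots> = (\<Sum>l<N. coeff Q l * fps_nth S (k + 1 + i - l))"
      using N that by (intro sum.mono_neutral_right) (auto simp: coeff_eq_0)
    also have "\<dots> = (\<Sum>j<N. coeff Q (N - Suc j) * fps_nth S (k + 1 + i - (N - Suc j)))"
      by (rule sum.nat_diff_reindex [symmetric])
    also have "\<dots> = (\<Sum>j<N. fps_nth S (k + 2 - N + i + j) * coeff Q (N - Suc j))"
    proof (rule sum.cong)
      fix j assume "j \<in> {..<N}"
      hence "k + 1 + i - (N - Suc j) = k + 2 - N + i + j" using N by auto
      thus "coeff Q (N - Suc j) * fps_nth S (k + 1 + i - (N - Suc j)) =
        fps_nth S (k + 2 - N + i + j) * coeff Q (N - Suc j)" by simp
    qed simp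
    finally show ?thesis .
  qed
  have range: "(\<forall>i<N. fps_nth F (k + 1 + i) = 0) \<longleftrightarrow> (\<forall>i. k < i \<and> i < n \<longrightarrow> fps_nth F i = 0)"
    for F :: "complex fps"
  proof safe
    fix i assume *: "\<forall>i<N. fps_nth F (k + 1 + i) = 0" "k < i" "i < n"
    from *(1)[rule_format, of "i - (k + 1)"] *(2,3) show "fps_nth F i = 0"
      by (simp add: n)
  qed (simp add: n)
  have "period_condition S n \<longleftrightarrow>
      (\<exists>v. (\<exists>j<N. v j \<noteq> 0) \<and> (\<forall>i<N. (\<Sum>j<N. fps_nth S (k + 2 - N + i + j) * v j) = 0))"
    unfolding period_condition_iff_hankel_det[OF assms] hankel_det_eq_0_iff N_def k_def ..
  also have "\<dots> \<longleftrightarrow> (\<exists>Q. Q \<noteq> 0 \<and> degree Q < N \<and> (\<forall>i<N. fps_nth (fps_of_poly Q * S) (k + 1 + i) = 0))"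
    (is "?L = ?R")
  proof
    assume ?L
    then obtain v j where v: "j < N" "v j \<noteq> 0" "\<forall>i<N. (\<Sum>j<N. fps_nth S (k + 2 - N + i + j) * v j) = 0"
      by blast
    define Q where "Q = truncate_fps N (Abs_fps (\<lambda>l. v (N - Suc l)))"
    have "degree Q < N"
      using v(1) unfolding Q_def by (intro degree_lessI) auto
    moreover have "Q \<noteq> 0"
    proof
      assume "Q = 0"
      hence "coeff Q (N - Suc j) = 0" by simp
      thus False using v(1,2) by (simp add: Q_def)
    qed
    moreover have "(\<Sum>j<N. fps_nth S (k + 2 - N + i + j) * coeff Q (N - Suc j)) =
        (\<Sum>j<N. fps_nth S (k + 2 - N + i + j) * v j)" for i
      by (rule sum.cong) (auto simp: Q_def)
    ultimately have "Q \<noteq> 0 \<and> degree Q < N \<and> (\<forall>i<N. fps_nth (fps_of_poly Q * S) (k + 1 + i) = 0)"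
      using v(3) by (simp only: nth) simp
    thus ?R by (rule exI)
  next
    assume ?R
    then obtain Q where Q: "Q \<noteq> 0" "degree Q < N" "\<forall>i<N. fps_nth (fps_of_poly Q * S) (k + 1 + i) = 0"
      by blast
    \<comment> \<open>In the reversed order this index holds the leading coefficient, so the vector
      is nonzero.\<close>
    have "N - Suc (N - Suc (degree Q)) = degree Q"
      using Q(2) by linarith
    hence "coeff Q (N - Suc (N - Suc (degree Q))) \<noteq> 0"
      using Q(1) by (simp only: leading_coeff_0_iff) simp
    moreover have "N - Suc (degree Q) < N" using Q(2) by simp
    ultimately have "\<exists>j<N. coeff Q (N - Suc j) \<noteq> 0"
      by (intro exI[of _ "N - Suc (degree Q)"] conjI)
    moreover have "\<forall>i<N. (\<Sum>j<N. fps_nth S (k + 2 - N + i + j) * coeff Q (N - Suc j)) = 0"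
      using Q(3) unfolding nth[OF Q(2)] .
    ultimately show ?L by (intro exI[of _ "\<lambda>j. coeff Q (N - Suc j)"] conjI)
  qed
  also have "\<dots> \<longleftrightarrow> (\<exists>Q. Q \<noteq> 0 \<and> degree Q < N \<and>
      (\<forall>i. k < i \<and> i < n \<longrightarrow> fps_nth (fps_of_poly Q * S) i = 0))"
    by (simp only: range)
  also have "\<dots> \<longleftrightarrow> (\<exists>P Q. pade_relation n S P Q)"
    unfolding ex_poly_cancels_iff [symmetric] by (auto simp: pade_relation_def N_def k_def)
  finally show ?thesis .
qed

lemma pade_relation_scale:
  fixes S :: "'a::field fps"
  assumes "pade_relation n S P Q"
  shows "pade_relation n (fps_const c * S) ([:c:] * P) Q"
proof -
  have "fps_of_poly ([:c:] * P) + fps_of_poly Q * (fps_const c * S) =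
      fps_const c * (fps_of_poly P + fps_of_poly Q * S)"
    by (simp only: fps_of_poly_mult fps_of_poly_const algebra_simps)
  moreover have "degree ([:c:] * P) \<le> degree P"
    by (rule degree_mult_le[THEN order_trans]) simp
  ultimately show ?thesis
    using assms by (auto simp: pade_relation_def simp del: mult_pCons_left)
qed

text \<open>The factor will be \<open>\<i>\<close> or \<open>- \<i>\<close>, passing from
  \<open>S\<close> to a square root of the negated radicand.\<close>

lemma period_condition_scale:
  assumes "n \<ge> 1" and "c \<noteq> 0"
  shows "period_condition (fps_const c * S) n \<longleftrightarrow> period_condition S n"
proof
  assume "period_condition (fps_const c * S) n"
  then obtain P Q where "pade_relation n (fps_const c * S) P Q"
    using assms by (auto simp: period_condition_iff_pade)
  moreover have "fps_const (inverse c) * (fps_const c * S) = S"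
  proof -
    have "fps_const (inverse c) * fps_const c = 1"
      using assms(2) by simp
    thus ?thesis by (simp only: mult_1_left flip: mult.assoc)
  qed
  ultimately have "pade_relation n S ([:inverse c:] * P) Q"
    using pade_relation_scale[of n "fps_const c * S" P Q "inverse c"] by (simp only:)
  thus "period_condition S n"
    using assms by (auto simp: period_condition_iff_pade)
next
  assume "period_condition S n"
  thus "period_condition (fps_const c * S) n"
    using assms by (auto simp: period_condition_iff_pade intro: pade_relation_scale)
qed

text \<open>Now \<open>P\<close> also has zero constant term, so \<open>P - Q * S\<close>
  contributes an extra factor \<open>X\<close> to the norm and forces it to be zero. But
  \<open>P ^ 2\<close> has even and \<open>Q ^ 2 * g\<close> odd degree.\<close>

lemma no_pade_relation_if_vanishing:
  fixes S :: "'a::field fps"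
  assumes "S\<^sup>2 = fps_of_poly g" and "degree g = 3" and "fps_nth S 0 = 0" and "n \<ge> 1"
  shows "\<not> pade_relation n S P Q"
proof
  assume pade: "pade_relation n S P Q"
  hence dvd: "fps_X ^ n dvd fps_of_poly P + fps_of_poly Q * S" and Q: "Q \<noteq> 0"
    by (auto simp: pade_relation_def)
  have "coeff P 0 = 0"
    using dvd assms(3,4) by (auto simp: fps_X_power_dvd_iff)
  hence "fps_X ^ 1 dvd fps_of_poly P - fps_of_poly Q * S"
    using assms(3) unfolding fps_X_power_dvd_iff by simp
  with dvd have "fps_X ^ n * fps_X ^ 1 dvd
      (fps_of_poly P + fps_of_poly Q * S) * (fps_of_poly P - fps_of_poly Q * S)"
    by (rule mult_dvd_mono)
  also have "\<dots> = fps_of_poly (P\<^sup>2 - Q\<^sup>2 * g)"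
    by (simp add: fps_of_poly_diff fps_of_poly_mult fps_of_poly_power flip: assms(1))
      (simp add: algebra_simps power2_eq_square)
  finally have "fps_X ^ (n + 1) dvd fps_of_poly (P\<^sup>2 - Q\<^sup>2 * g)"
    by (simp only: power_add)
  hence "coeff (P\<^sup>2 - Q\<^sup>2 * g) n = 0"
    unfolding fps_X_power_dvd_iff by simp
  with pade_norm[OF pade assms(1,2)] have "P\<^sup>2 - Q\<^sup>2 * g = 0"
    by simp
  hence "degree (P\<^sup>2) = degree (Q\<^sup>2 * g)" by simp
  moreover have "degree (Q\<^sup>2 * g) = 2 * degree Q + 3"
    using Q assms(2) by (subst degree_mult_eq) (auto simp: power2_eq_square degree_mult_eq)
  moreover have "degree (P\<^sup>2) = 2 * degree P"
    by (cases "P = 0") (auto simp: power2_eq_square degree_mult_eq)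
  ultimately show False by presburger
qed

section \<open>The squared diagonals\<close>

text \<open>The cubic \<open>g\<close> of the chords in terms of the coefficients of the
  Cayley--Menger relation, with \<open>t = c / 2\<close>.\<close>

definition diagonal_cubic :: "real \<Rightarrow> real \<Rightarrow> real \<Rightarrow> real \<Rightarrow> complex poly" where
  "diagonal_cubic s k l c =
     [:of_real ((c / 2)\<^sup>2), of_real (c * s / 2 - k * l), of_real (s\<^sup>2 / 4 + k + l), -1:]"

text \<open>The relation \<open>planar\<close> is quadratic in each diagonal. The step equations are
  Vieta's root sums, which remain meaningful at a double root.\<close>

locale diagonal_sequence =
  fixes p q :: "nat \<Rightarrow> real" and s k l c :: real
  assumes p_pos: "p j > 0" and q_pos: "q j > 0"
    and planar: "p j * q j * (s - p j - q j) + k * q j + l * p j + c = 0"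
    and q_step: "p j * (q j + q (Suc j)) = s * p j - (p j)\<^sup>2 + k"
    and p_step: "q (Suc j) * (p j + p (Suc j)) = s * q (Suc j) - (q (Suc j))\<^sup>2 + l"
begin

definition x :: "nat \<Rightarrow> real" where "x j = p j * q j"

definition m :: "nat \<Rightarrow> real" where "m j = p j + q (Suc j) - s / 2"

text \<open>Vieta's product of the two roots \<open>q\<close>, derived from their sum and
  \<open>planar\<close>.\<close>

lemma q_prod: "p j * q j * q (Suc j) = - (l * p j + c)"
proof -
  have "p j * q j * q (Suc j) = q j * (p j * (q j + q (Suc j))) - p j * q j * q j"
    by (simp add: algebra_simps)
  also have "\<dots> = p j * q j * (s - p j - q j) + k * q j"
    unfolding q_step by (simp add: algebra_simps power2_eq_square)
  finally show ?thesis using planar[of j] by linarith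
qed

lemma p_prod: "p j * q (Suc j) * p (Suc j) = - (k * q (Suc j) + c)"
proof -
  have "p j * q (Suc j) * p (Suc j) =
      p (Suc j) * (q (Suc j) * (p j + p (Suc j))) - p (Suc j) * q (Suc j) * p (Suc j)"
    by (simp add: algebra_simps)
  also have "\<dots> = p (Suc j) * q (Suc j) * (s - p (Suc j) - q (Suc j)) + l * p (Suc j)"
    unfolding p_step by (simp add: algebra_simps power2_eq_square)
  finally show ?thesis using planar[of "Suc j"] by linarith
qed

lemma planar_mid: "p j * q (Suc j) * (s - p j - q (Suc j)) + k * q (Suc j) + l * p j + c = 0"
proof -
  have "p j * q (Suc j) * (s - p j - q (Suc j)) + k * q (Suc j) =
      q (Suc j) * (s * p j - (p j)\<^sup>2 + k) - p j * q (Suc j) * q (Suc j)"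
    by (simp add: algebra_simps power2_eq_square)
  also have "\<dots> = p j * q j * q (Suc j)"
    unfolding q_step [symmetric] by (simp add: algebra_simps)
  finally show ?thesis using q_prod[of j] by linarith
qed

text \<open>This is the coefficient of \<open>X ^ 2\<close> in the chord equation;
  \<open>prod_x\<close> is that of \<open>X\<close>.\<close>

lemma sum_x: "(m j)\<^sup>2 + x j + x (Suc j) = s\<^sup>2 / 4 + k + l"
proof -
  have "x j = s * p j - (p j)\<^sup>2 + k - p j * q (Suc j)"
    using q_step[of j] by (simp add: x_def algebra_simps)
  moreover have "x (Suc j) = s * q (Suc j) - (q (Suc j))\<^sup>2 + l - p j * q (Suc j)"
    using p_step[of j] by (simp add: x_def algebra_simps)
  ultimately show ?thesis
    by (simp add: m_def power2_eq_square field_simps)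
qed

lemma prod_x: "c * m j - x j * x (Suc j) = c * s / 2 - k * l"
proof -
  \<comment> \<open>The extra positive factor regroups the product into the two Vieta products; it
    is cancelled afterwards.\<close>
  have "p j * q (Suc j) * (x j * x (Suc j)) = p j * q (Suc j) * (k * l + c * (p j + q (Suc j) - s))"
  proof -
    have "p j * q (Suc j) * (x j * x (Suc j)) = (p j * q j * q (Suc j)) * (p j * q (Suc j) * p (Suc j))"
      by (simp add: x_def)
    also have "\<dots> = p j * q (Suc j) * (k * l) + c * (k * q (Suc j) + l * p j + c)"
      unfolding q_prod p_prod by (simp add: algebra_simps)
    also have "k * q (Suc j) + l * p j + c = - (p j * q (Suc j) * (s - p j - q (Suc j)))"
      using planar_mid[of j] by linarith
    finally show ?thesis by (simp add: algebra_simps)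
  qed
  hence "x j * x (Suc j) = k * l + c * (p j + q (Suc j) - s)"
    using p_pos[of j] q_pos[of "Suc j"] by (subst (asm) mult_cancel_left) auto
  thus ?thesis by (simp add: m_def algebra_simps)
qed

lemma slope_relation: "c + (m j + m (Suc j)) * x (Suc j) = 0"
proof -
  have "(m j + m (Suc j)) * x (Suc j) =
      p (Suc j) * (q (Suc j) * (p j + p (Suc j))) + q (Suc j) * (p (Suc j) * (q (Suc j) + q (Suc (Suc j))))
      - s * p (Suc j) * q (Suc j)"
    by (simp add: m_def x_def field_simps)
  also have "\<dots> = - c"
    unfolding p_step q_step using planar[of "Suc j"] by (simp add: algebra_simps power2_eq_square)
  finally show ?thesis by simp
qed

lemma chord_sequence:
  assumes "c \<noteq> 0" and "R\<^sup>2 = fps_of_poly (diagonal_cubic s k l c)" and "fps_nth R 0 = of_real (c / 2)"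
  shows "chord_sequence (diagonal_cubic s k l c) R (of_real (c / 2))
    (\<lambda>j. of_real (x j)) (\<lambda>j. of_real (m j))"
proof
  fix j
  show "complex_of_real (x j) \<noteq> 0"
    using p_pos[of j] q_pos[of j] by (simp add: x_def)
  have "complex_of_real (s\<^sup>2 / 4 + k + l) = (of_real (m j))\<^sup>2 + of_real (x j) + of_real (x (Suc j))"
    unfolding sum_x[of j, symmetric] by simp
  note E1 = this
  have E2: "complex_of_real (c * s / 2 - k * l) = of_real c * of_real (m j) - of_real (x j) * of_real (x (Suc j))"
    unfolding prod_x[of j, symmetric] by simp
  show "diagonal_cubic s k l c = [:of_real (c / 2), of_real (m j):]\<^sup>2 -
      [:0, 1:] * [:- of_real (x j), 1:] * [:- of_real (x (Suc j)), 1:]"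
    unfolding diagonal_cubic_def E1 E2 by (simp add: power2_eq_square algebra_simps)
  have "complex_of_real (c + (m j + m (Suc j)) * x (Suc j)) = 0"
    unfolding slope_relation by simp
  thus "2 * complex_of_real (c / 2) + (of_real (m j) + of_real (m (Suc j))) * of_real (x (Suc j)) = 0"
    by simp
qed (use assms in auto)

text \<open>The orbit that starts after the first folding of \<open>D\<close>, with the two diagonals exchanged. Both
  orbits are needed: for an antiparallelogram \<open>x\<close> and \<open>m\<close> are constant (the point sits in a node of
  the curve) and only the other orbit carries information.\<close>

lemma half_shift: "diagonal_sequence (\<lambda>j. q (Suc j)) p s l k c"
proof
  fix j
  show "q (Suc j) * p j * (s - q (Suc j) - p j) + l * p j + k * q (Suc j) + c = 0"
    using planar_mid[of j] by (simp add: algebra_simps)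
qed (use p_pos q_pos p_step q_step in auto)

lemma shift: "diagonal_sequence (\<lambda>j. p (j + i)) (\<lambda>j. q (j + i)) s k l c"
  using p_pos q_pos planar p_step q_step by unfold_locales auto

text \<open>A Pade relation does not mention the starting index, so \<open>pade_imp_return\<close>
  applies to every shift of the orbit. Then \<open>prod_x\<close> recovers \<open>m\<close> because
  \<open>c \<noteq> 0\<close>.\<close>

lemma pade_imp_periodic_x_m:
  assumes "c \<noteq> 0" and "R\<^sup>2 = fps_of_poly (diagonal_cubic s k l c)" and "fps_nth R 0 = of_real (c / 2)"
    and "pade_relation n R P Q"
  shows "x (j + n) = x j" and "m (j + n) = m j"
proof -
  interpret chord_sequence "diagonal_cubic s k l c" R "of_real (c / 2)"
    "\<lambda>j. of_real (x j)" "\<lambda>j. of_real (m j)"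
    using assms(1-3) by (rule chord_sequence)
  have x: "x (j + n) = x j" for j
    using chord_sequence.pade_imp_return[OF shift assms(4), of j] by (simp add: add.commute)
  show "x (j + n) = x j" by (rule x)
  have xs: "x (Suc (j + n)) = x (Suc j)"
    using x[of "Suc j"] by simp
  have "c * m (j + n) = c * m j"
    using prod_x[of j] prod_x[of "j + n"] unfolding x xs by linarith
  thus "m (j + n) = m j" using assms(1) by simp
qed

lemma step_unique:
  assumes "p i = p j" and "q i = q j"
  shows "q (Suc i) = q (Suc j)" and "p (Suc i) = p (Suc j)"
proof -
  have "p j * (q j + q (Suc i)) = p j * (q j + q (Suc j))"
    using q_step[of i] unfolding q_step[of j] assms .
  thus q: "q (Suc i) = q (Suc j)"
    using p_pos[of j] by simp
  have "q (Suc j) * (p j + p (Suc i)) = q (Suc j) * (p j + p (Suc j))"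
    using p_step[of i] unfolding p_step[of j] assms q .
  thus "p (Suc i) = p (Suc j)"
    using q_pos[of "Suc j"] by simp
qed

lemma periodic_if_returns:
  assumes "p n = p 0" and "q n = q 0"
  shows "p (j + n) = p j \<and> q (j + n) = q j"
proof (induction j)
  case (Suc j)
  thus ?case using step_unique[of "j + n" j] by simp
qed (use assms in simp)

lemma q_unique_backwards:
  assumes "p i = p j" and "q (Suc i) = q (Suc j)"
  shows "q i = q j"
proof -
  have "p j * (q i + q (Suc j)) = p j * (q j + q (Suc j))"
    using q_step[of i] unfolding q_step[of j] assms .
  thus ?thesis using p_pos[of j] by simp
qed

lemma p_unique_backwards:
  assumes "q (Suc i) = q (Suc j)" and "p (Suc i) = p (Suc j)"
  shows "p i = p j"
proof -
  have "q (Suc j) * (p i + p (Suc j)) = q (Suc j) * (p j + p (Suc j))"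
    using p_step[of i] unfolding p_step[of j] assms .
  thus ?thesis using q_pos[of "Suc j"] by simp
qed

lemma returns_imp_pade:
  assumes "c \<noteq> 0" and "R\<^sup>2 = fps_of_poly (diagonal_cubic s k l c)" and "fps_nth R 0 = of_real (c / 2)"
    and "n \<ge> 1" and "p n = p 0" and "q n = q 0" and nz: "m (Suc j) \<noteq> m j"
  shows "\<exists>P Q. pade_relation n R P Q"
proof -
  interpret chord_sequence "diagonal_cubic s k l c" R "of_real (c / 2)"
    "\<lambda>j. of_real (x j)" "\<lambda>j. of_real (m j)"
    using assms(1-3) by (rule chord_sequence)
  note per = periodic_if_returns[OF assms(5,6)]
  have x: "x (n + Suc j) = x (Suc j)" and m: "m (n + Suc j) = m (Suc j)"
    using per[of "Suc j"] per[of "Suc (Suc j)"] by (simp_all add: x_def m_def add.commute)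
  have "x (Suc j) \<noteq> 0"
    using p_pos[of "Suc j"] q_pos[of "Suc j"] by (simp add: x_def)
  \<comment> \<open>By \<open>slope_relation\<close>, a change of slope is what makes the ordinate
    over \<open>x (Suc j)\<close> nonzero.\<close>
  moreover have "2 * (c / 2 + m (Suc j) * x (Suc j)) = (m (Suc j) - m j) * x (Suc j)"
    using slope_relation[of j] unfolding distrib_right left_diff_distrib distrib_left by linarith
  ultimately have "2 * (c / 2 + m (Suc j) * x (Suc j)) \<noteq> 0"
    using nz by simp
  hence "c / 2 + m (Suc j) * x (Suc j) \<noteq> 0"
    by simp
  hence "complex_of_real (c / 2 + m (Suc j) * x (Suc j)) \<noteq> 0"
    unfolding of_real_eq_0_iff .
  hence "complex_of_real (c / 2) + of_real (m (0 + Suc j)) * of_real (x (0 + Suc j)) \<noteq> 0"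
    by simp
  thus ?thesis
    using x m by (intro chord_sequence.return_imp_pade[OF shift[of "Suc j"] assms(4)]) auto
qed

text \<open>With equal consecutive slopes, \<open>slope_relation\<close> reads
  \<open>c + 2 * m j * x (Suc j) = 0\<close>, and \<open>c \<noteq> 0\<close> makes the slope
  nonzero.\<close>

lemma x_determined_if_m_eq:
  assumes "c \<noteq> 0" and "m j = m i" and "m (Suc j) = m (Suc i)" and "m j = m (Suc j)"
  shows "x (Suc j) = x (Suc i)"
proof -
  have eqs: "m (Suc j) = m j" "m i = m j" "m (Suc i) = m j"
    using assms by simp_all
  have "(2 * m j) * x (Suc j) = (2 * m j) * x (Suc i)"
    using slope_relation[of j] slope_relation[of i] unfolding eqs mult_2 [symmetric] by linarith
  moreover have "m j \<noteq> 0"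
    using slope_relation[of j] assms by auto
  ultimately show ?thesis by simp
qed

end

lemma sum_product_eq_cases:
  fixes a b c d :: "'a::idom"
  assumes "a + b = c + d" and "a * b = c * d"
  shows "a = c \<and> b = d \<or> a = d \<and> b = c"
proof -
  have "(a - c) * (a - d) = a * a - a * (c + d) + c * d"
    by (simp add: algebra_simps)
  also have "\<dots> = 0"
    unfolding assms [symmetric] by (simp add: algebra_simps)
  finally have "a = c \<or> a = d" by simp
  thus ?thesis using assms(1) by auto
qed

context diagonal_sequence
begin

interpretation half: diagonal_sequence "\<lambda>j. q (Suc j)" p s l k c
  by (rule half_shift)

lemma half_x: "half.x j = q (Suc j) * p j" and half_m: "half.m j = q (Suc j) + p (Suc j) - s / 2"
  by (simp_all add: half.x_def half.m_def)

text \<open>Constant slopes in both orbits force constant \<open>x\<close> in both, hence equal sums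
  and products of successive diagonal pairs. The orbit is then stationary, and running it backwards
  contradicts \<open>moving\<close>.\<close>

lemma slopes_not_constant:
  assumes "c \<noteq> 0" and moving: "\<not> (q 1 = q 0 \<and> p 1 = p 0)"
  shows "m 1 \<noteq> m 0 \<or> m 2 \<noteq> m 1 \<or> half.m 1 \<noteq> half.m 0 \<or> half.m 2 \<noteq> half.m 1"
proof (rule ccontr)
  assume "\<not> ?thesis"
  hence m: "m 1 = m 0" "m 2 = m 1" and hm: "half.m 1 = half.m 0" "half.m 2 = half.m 1"
    by auto
  have "m 0 = m 1" "m (Suc 0) = m (Suc 1)" "m 0 = m (Suc 0)"
    using m by (simp_all add: numeral_2_eq_2)
  from x_determined_if_m_eq[OF assms(1) this] have x: "x 1 = x 2"
    by (simp add: numeral_2_eq_2)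
  have "half.m 0 = half.m 1" "half.m (Suc 0) = half.m (Suc 1)" "half.m 0 = half.m (Suc 0)"
    using hm by (simp_all add: numeral_2_eq_2)
  from half.x_determined_if_m_eq[OF assms(1) this] have hx: "half.x 1 = half.x 2"
    by (simp add: numeral_2_eq_2)
  have "p 1 + q 1 = p 2 + q 2" "p 1 * q 1 = p 2 * q 2"
    using hm x by (simp_all add: half_m x_def numeral_2_eq_2)
  hence 1: "p 1 = p 2 \<and> q 1 = q 2 \<or> p 1 = q 2 \<and> q 1 = p 2"
    by (rule sum_product_eq_cases)
  have "p 1 + q 2 = p 2 + q 3" "p 1 * q 2 = p 2 * q 3"
    using m hx by (simp_all add: m_def half_x numeral_2_eq_2 numeral_3_eq_3 mult.commute)
  hence 2: "p 1 = p 2 \<and> q 2 = q 3 \<or> p 1 = q 3 \<and> q 2 = p 2"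
    by (rule sum_product_eq_cases)
  \<comment> \<open>Even the alternatives that swap the two diagonals collapse to this one when
    combined.\<close>
  have "p 1 = p 2 \<and> q 1 = q 2"
    using 1 2 by (elim disjE conjE) simp_all
  hence eq: "p (Suc 0) = p (Suc 1)" "q (Suc 0) = q (Suc 1)"
    by (simp_all add: numeral_2_eq_2)
  have "p 0 = p 1"
    using eq(2,1) by (rule p_unique_backwards)
  moreover from this eq(2) have "q 0 = q 1"
    by (rule q_unique_backwards)
  ultimately show False using moving by simp
qed

lemma period_condition_iff_returns:
  assumes "c \<noteq> 0" and R: "R\<^sup>2 = fps_of_poly (diagonal_cubic s k l c)" "fps_nth R 0 = of_real (c / 2)"
    and "n \<ge> 1" and moving: "\<not> (q 1 = q 0 \<and> p 1 = p 0)"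
  shows "period_condition R n \<longleftrightarrow> p n = p 0 \<and> q n = q 0"
proof -
  \<comment> \<open>The cubic is symmetric in \<open>k\<close> and \<open>l\<close>, so the same
    root \<open>R\<close> serves the orbit with exchanged diagonals.\<close>
  have R': "R\<^sup>2 = fps_of_poly (diagonal_cubic s l k c)"
    unfolding R by (simp add: diagonal_cubic_def ac_simps)
  show ?thesis
  proof
    assume "period_condition R n"
    then obtain P Q where pade: "pade_relation n R P Q"
      using period_condition_iff_pade[OF \<open>n \<ge> 1\<close>] by blast
    note x = pade_imp_periodic_x_m(1)[OF assms(1) R pade]
      and m = pade_imp_periodic_x_m(2)[OF assms(1) R pade]
      and hx = half.pade_imp_periodic_x_m(1)[OF assms(1) R' R(2) pade]
      and hm = half.pade_imp_periodic_x_m(2)[OF assms(1) R' R(2) pade]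
    \<comment> \<open>The increments \<open>d\<close> and \<open>e\<close> compare the two
      interleaved orbits. They are periodic, and so are \<open>q (Suc j) * d j\<close> and
      \<open>p (Suc j) * e j\<close>; a nonzero increment therefore recovers a diagonal.\<close>
    define d where "d j = p (Suc j) - p j" for j
    define e where "e j = q (Suc (Suc j)) - q (Suc j)" for j
    have d: "d (j + n) = d j" for j
      using hm[of j] m[of j] by (simp add: half_m m_def d_def)
    have e: "e (j + n) = e j" for j
      using hm[of j] m[of "Suc j"] by (simp add: half_m m_def e_def)
    have qd: "q (Suc j) * d j = x (Suc j) - half.x j" for j
      by (simp add: half_x x_def d_def algebra_simps)
    have pe: "p (Suc j) * e j = half.x (Suc j) - x (Suc j)" for j
      by (simp add: half_x x_def e_def algebra_simps)
    have "q (Suc n) * d 0 = q 1 * d 0"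
      using qd[of n] qd[of 0] x[of 1] hx[of 0] d[of 0] by simp
    moreover have "p (Suc n) * e 0 = p 1 * e 0"
      using pe[of n] pe[of 0] x[of 1] hx[of 1] e[of 0] by simp
    moreover have "d 0 \<noteq> 0 \<or> e 0 \<noteq> 0"
    proof (rule ccontr)
      assume "\<not> ?thesis"
      hence "p 1 = p 0" "q 2 = q 1" by (simp_all add: d_def e_def numeral_2_eq_2)
      with moving q_unique_backwards[of 1 0] show False
        by (simp add: numeral_2_eq_2)
    qed
    ultimately have "q (Suc n) = q 1 \<or> p (Suc n) = p 1" by auto
    hence "q (Suc n) = q 1 \<and> p n = p 0"
      using m[of 0] hm[of 0] d[of 0] by (auto simp: m_def half_m d_def)
    thus "p n = p 0 \<and> q n = q 0"
      using q_unique_backwards[of n 0] by simp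
  next
    assume "p n = p 0 \<and> q n = q 0"
    hence ret: "p n = p 0" "q n = q 0" by auto
    hence hret: "q (Suc n) = q (Suc 0)" by (rule step_unique)
    \<comment> \<open>A change of slope in either orbit provides the nonzero ordinate that the
      cancellation needs.\<close>
    have "\<exists>P Q. pade_relation n R P Q"
      using slopes_not_constant[OF assms(1) moving]
    proof (elim disjE)
      assume "m 1 \<noteq> m 0"
      thus ?thesis
        using returns_imp_pade[OF assms(1) R \<open>n \<ge> 1\<close> ret, of 0] by simp
    next
      assume "m 2 \<noteq> m 1"
      thus ?thesis
        using returns_imp_pade[OF assms(1) R \<open>n \<ge> 1\<close> ret, of 1] by (simp add: numeral_2_eq_2)
    next
      assume "half.m 1 \<noteq> half.m 0"
      thus ?thesis
        using half.returns_imp_pade[OF assms(1) R' R(2) \<open>n \<ge> 1\<close> hret ret(1), of 0] by simp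
    next
      assume "half.m 2 \<noteq> half.m 1"
      thus ?thesis
        using half.returns_imp_pade[OF assms(1) R' R(2) \<open>n \<ge> 1\<close> hret ret(1), of 1]
        by (simp add: numeral_2_eq_2)
    qed
    thus "period_condition R n"
      using period_condition_iff_pade[OF \<open>n \<ge> 1\<close>] by blast
  qed
qed

end

section \<open>Reflections and plane quadrilaterals\<close>

lemma dist_square_plane:
  fixes X Y :: "real ^ 2"
  shows "(dist X Y)\<^sup>2 = (X $ 1 - Y $ 1)\<^sup>2 + (X $ 2 - Y $ 2)\<^sup>2"
  unfolding dist_norm power2_norm_eq_inner by (simp add: inner_vec_def sum_2 power2_eq_square)

text \<open>\<open>F\<close> is the foot of the perpendicular, so Pythagoras makes it the closest
  point of the line.\<close>

lemma reflect_line_eq: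
  assumes "P \<noteq> Q"
  shows "reflect_line P Q X =
    2 *\<^sub>R (P + (((X - P) \<bullet> (Q - P)) / ((Q - P) \<bullet> (Q - P))) *\<^sub>R (Q - P)) - X"
proof -
  define e where "e = Q - P"
  define s where "s = ((X - P) \<bullet> e) / (e \<bullet> e)"
  define F where "F = P + s *\<^sub>R e"
  have e: "e \<bullet> e \<noteq> 0" using assms by (simp add: e_def)
  have orth: "(X - F) \<bullet> e = 0"
    using e by (simp add: F_def s_def inner_diff_left inner_add_left)
  have "F = (1 - s) *\<^sub>R P + s *\<^sub>R Q"
    by (simp add: F_def e_def algebra_simps)
  hence "F \<in> affine hull {P, Q}"
    unfolding affine_hull_2 mem_Collect_eq by (intro exI[of _ "1 - s"] exI[of _ s] conjI) simp_all
  moreover have "dist X F \<le> dist X Z" if Z: "Z \<in> affine hull {P, Q}" for Z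
  proof -
    from Z obtain u v where "Z = u *\<^sub>R P + v *\<^sub>R Q" "u + v = 1"
      unfolding affine_hull_2 by blast
    hence "Z = P + v *\<^sub>R e"
      by (simp add: e_def algebra_simps flip: scaleR_add_left)
    hence Z: "F - Z = (s - v) *\<^sub>R e" by (simp add: F_def algebra_simps)
    have "(dist X Z)\<^sup>2 = (norm ((X - F) + (F - Z)))\<^sup>2" by (simp add: dist_norm)
    also have "\<dots> = (dist X F)\<^sup>2 + (norm (F - Z))\<^sup>2"
      using orth unfolding dist_norm power2_norm_eq_inner Z
      by (simp add: inner_add_left inner_add_right inner_commute)
    finally have "(dist X F)\<^sup>2 \<le> (dist X Z)\<^sup>2" by simp
    thus ?thesis by (simp add: power2_le_iff_abs_le)
  qed
  ultimately have "F = closest_point (affine hull {P, Q}) X"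
    by (intro closest_point_unique) (auto simp: affine_imp_convex)
  thus ?thesis by (simp add: reflect_line_def F_def s_def e_def)
qed

lemma dist_reflect_line:
  assumes "P \<noteq> Q"
  shows "dist P (reflect_line P Q X) = dist P X" and "dist Q (reflect_line P Q X) = dist Q X"
proof -
  define e where "e = Q - P"
  define s where "s = ((X - P) \<bullet> e) / (e \<bullet> e)"
  have "e \<bullet> e \<noteq> 0" using assms by (simp add: e_def)
  hence s: "s * (e \<bullet> e) = (X - P) \<bullet> e" by (simp add: s_def)
  have refl: "reflect_line P Q X = 2 *\<^sub>R (P + s *\<^sub>R e) - X"
    unfolding reflect_line_eq[OF assms] s_def e_def ..
  have *: "dist (P + r *\<^sub>R e) (reflect_line P Q X) = dist (P + r *\<^sub>R e) X" for r
  proof -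
    have "(dist (P + r *\<^sub>R e) (reflect_line P Q X))\<^sup>2 =
        (norm ((X - P) + (r - 2 * s) *\<^sub>R e))\<^sup>2"
      unfolding refl dist_norm by (simp add: algebra_simps scaleR_2)
    also have "\<dots> = (norm ((X - P) - r *\<^sub>R e))\<^sup>2 + 4 * (r - s) * ((X - P) \<bullet> e - s * (e \<bullet> e))"
      by (simp add: power2_norm_eq_inner inner_add_left inner_add_right inner_diff_left
          inner_diff_right inner_commute algebra_simps)
    also have "\<dots> = (dist (P + r *\<^sub>R e) X)\<^sup>2"
      unfolding s by (simp add: dist_norm norm_minus_commute algebra_simps)
    finally show ?thesis by simp
  qed
  show "dist P (reflect_line P Q X) = dist P X" using *[of 0] by simp
  show "dist Q (reflect_line P Q X) = dist Q X" using *[of 1] by (simp add: e_def)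
qed

lemma inner_eq_dist:
  fixes X Y P :: "'a::real_inner"
  shows "2 * ((X - P) \<bullet> (Y - P)) = (dist P X)\<^sup>2 + (dist P Y)\<^sup>2 - (dist X Y)\<^sup>2"
  by (simp add: dist_norm power2_norm_eq_inner inner_diff_left inner_diff_right inner_commute)

text \<open>In the sum the components of \<open>X\<close> and its image across the line cancel; what
  remains are inner products with \<open>Q - P\<close>, given by the law of cosines. This is the
  geometric source of the root sums, including the case of a fixed \<open>X\<close>.\<close>

lemma dist_reflect_line_sum:
  assumes "P \<noteq> Q"
  shows "(dist P Q)\<^sup>2 * ((dist Z X)\<^sup>2 + (dist Z (reflect_line P Q X))\<^sup>2) =
    2 * (dist P Q)\<^sup>2 * ((dist P Z)\<^sup>2 + (dist P X)\<^sup>2) -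
    ((dist P Z)\<^sup>2 + (dist P Q)\<^sup>2 - (dist Q Z)\<^sup>2) * ((dist P X)\<^sup>2 + (dist P Q)\<^sup>2 - (dist Q X)\<^sup>2)"
proof -
  define e where "e = Q - P"
  define s where "s = ((X - P) \<bullet> e) / (e \<bullet> e)"
  have "e \<bullet> e \<noteq> 0" using assms by (simp add: e_def)
  hence s: "s * (e \<bullet> e) = (X - P) \<bullet> e" by (simp add: s_def)
  have e: "(dist P Q)\<^sup>2 = e \<bullet> e"
    by (metis dist_norm dist_commute power2_norm_eq_inner e_def)
  have refl: "reflect_line P Q X - P = (2 * s) *\<^sub>R e - (X - P)"
    unfolding reflect_line_eq[OF assms] e_def[symmetric] s_def[symmetric] by (simp add: scaleR_2 algebra_simps)
  have "(dist Z X)\<^sup>2 + (dist Z (reflect_line P Q X))\<^sup>2 =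
      2 * ((dist P Z)\<^sup>2 + (dist P X)\<^sup>2) - 2 * ((Z - P) \<bullet> (X - P)) - 2 * ((Z - P) \<bullet> (reflect_line P Q X - P))"
    unfolding inner_eq_dist dist_reflect_line(1)[OF assms] by simp
  also have "\<dots> = 2 * ((dist P Z)\<^sup>2 + (dist P X)\<^sup>2) - 4 * s * ((Z - P) \<bullet> e)"
    unfolding refl by (simp add: inner_diff_right algebra_simps)
  finally have sum: "(dist Z X)\<^sup>2 + (dist Z (reflect_line P Q X))\<^sup>2 = \<dots>" .
  have "(dist P Q)\<^sup>2 * ((dist Z X)\<^sup>2 + (dist Z (reflect_line P Q X))\<^sup>2) =
      2 * (dist P Q)\<^sup>2 * ((dist P Z)\<^sup>2 + (dist P X)\<^sup>2) - 4 * (s * (e \<bullet> e)) * ((Z - P) \<bullet> e)"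
    unfolding sum e by (simp add: algebra_simps)
  also have "\<dots> = 2 * (dist P Q)\<^sup>2 * ((dist P Z)\<^sup>2 + (dist P X)\<^sup>2)
      - (2 * ((Z - P) \<bullet> (Q - P))) * (2 * ((X - P) \<bullet> (Q - P)))"
    unfolding s by (simp add: e_def)
  finally show ?thesis
    unfolding inner_eq_dist by (simp add: dist_commute)
qed

lemma collinear_if_collinear_reflect_line:
  assumes "P \<noteq> Q" and "collinear {P, Q, reflect_line P Q X}"
  shows "collinear {P, Q, X}"
proof -
  have "reflect_line P Q X \<in> affine hull {P, Q}"
    using assms collinear_3_affine_hull by blast
  then obtain u v where uv: "reflect_line P Q X = u *\<^sub>R P + v *\<^sub>R Q" "u + v = 1"
    unfolding affine_hull_2 by blast
  define s where "s = ((X - P) \<bullet> (Q - P)) / ((Q - P) \<bullet> (Q - P))"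
  have "X = 2 *\<^sub>R (P + s *\<^sub>R (Q - P)) - reflect_line P Q X"
    unfolding reflect_line_eq[OF assms(1)] s_def by simp
  also have "\<dots> = (2 - 2 * s - u) *\<^sub>R P + (2 * s - v) *\<^sub>R Q"
    unfolding uv by (simp add: algebra_simps scaleR_2)
  finally have "X \<in> affine hull {P, Q}"
    unfolding affine_hull_2 using uv(2) by force
  thus ?thesis using assms(1) collinear_3_affine_hull by blast
qed

lemma reflect_line_fixed:
  assumes "P \<noteq> Q" and "collinear {P, Q, X}"
  shows "reflect_line P Q X = X"
proof -
  have "X \<in> affine hull {P, Q}"
    using assms collinear_3_affine_hull by blast
  thus ?thesis by (simp add: reflect_line_def closest_point_self scaleR_2)
qed

text \<open>Lagrange's identity turns a vanishing cross product into equality in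
  Cauchy--Schwarz.\<close>

lemma collinear_if_cross_product_eq:
  fixes P X Y :: "real ^ 2"
  assumes "(X $ 1 - P $ 1) * (Y $ 2 - P $ 2) = (X $ 2 - P $ 2) * (Y $ 1 - P $ 1)"
  shows "collinear {P, X, Y}"
proof -
  let ?x = "X - P" and ?y = "Y - P"
  have "(?x \<bullet> ?y)\<^sup>2 = (norm ?x * norm ?y)\<^sup>2 -
      ((X $ 1 - P $ 1) * (Y $ 2 - P $ 2) - (X $ 2 - P $ 2) * (Y $ 1 - P $ 1))\<^sup>2"
    unfolding power_mult_distrib power2_norm_eq_inner
    by (simp add: inner_vec_def sum_2 power2_eq_square algebra_simps)
  hence "(?x \<bullet> ?y)\<^sup>2 = (norm ?x * norm ?y)\<^sup>2"
    using assms by simp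
  hence "\<bar>?x \<bullet> ?y\<bar> = \<bar>norm ?x * norm ?y\<bar>"
    unfolding power2_eq_iff by auto
  hence "collinear {0, ?x, ?y}"
    by (simp add: norm_cauchy_schwarz_equal)
  hence "collinear {X, P, Y}" by (simp add: collinear_3[of X P Y])
  thus ?thesis by (simp add: insert_commute)
qed

text \<open>If \<open>X\<close> moves, its displacement is a nonzero vector orthogonal to both
  \<open>Q - P\<close> and \<open>Z - P\<close>, which are then parallel in the plane. If not,
  \<open>X\<close> lies on the line.\<close>

lemma collinear_if_dist_reflect_line_eq:
  fixes P Q X Z :: "real ^ 2"
  assumes "P \<noteq> Q" and "dist Z (reflect_line P Q X) = dist Z X"
  shows "collinear {P, Q, X} \<or> collinear {P, Q, Z}"
proof (cases "reflect_line P Q X = X")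
  case True
  define s where "s = ((X - P) \<bullet> (Q - P)) / ((Q - P) \<bullet> (Q - P))"
  have "2 *\<^sub>R (P + s *\<^sub>R (Q - P)) = 2 *\<^sub>R X"
    using True unfolding reflect_line_eq[OF assms(1)] s_def by (simp add: diff_eq_eq scaleR_2)
  hence "P + s *\<^sub>R (Q - P) = X"
    by (simp only: scaleR_cancel_left) simp
  hence "X = (1 - s) *\<^sub>R P + s *\<^sub>R Q"
    by (auto simp: algebra_simps)
  hence "X \<in> affine hull {P, Q}"
    unfolding affine_hull_2 mem_Collect_eq by (intro exI[of _ "1 - s"] exI[of _ s] conjI) simp_all
  thus ?thesis using assms(1) collinear_3_affine_hull by blast
next
  case False
  let ?X = "reflect_line P Q X"
  define w where "w = ?X - X"
  have orth: "(Y - P) \<bullet> w = 0" if "dist Y ?X = dist Y X" for Y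
    using inner_eq_dist[of Y P X] inner_eq_dist[of Y P ?X] that dist_reflect_line(1)[OF assms(1), of X]
    by (simp add: w_def inner_diff_right)
  have "(Q - P) \<bullet> w = 0" "(Z - P) \<bullet> w = 0"
    using orth assms dist_reflect_line(2) by blast+
  hence eqs: "(Q $ 1 - P $ 1) * w $ 1 + (Q $ 2 - P $ 2) * w $ 2 = 0"
      "(Z $ 1 - P $ 1) * w $ 1 + (Z $ 2 - P $ 2) * w $ 2 = 0"
    by (simp_all add: inner_vec_def sum_2)
  have "w $ 1 \<noteq> 0 \<or> w $ 2 \<noteq> 0"
    using False by (auto simp: w_def Finite_Cartesian_Product.vec_eq_iff forall_2)
  moreover have "w $ 1 * ((Q $ 1 - P $ 1) * (Z $ 2 - P $ 2) - (Q $ 2 - P $ 2) * (Z $ 1 - P $ 1)) =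
      (Z $ 2 - P $ 2) * ((Q $ 1 - P $ 1) * w $ 1 + (Q $ 2 - P $ 2) * w $ 2)
      - (Q $ 2 - P $ 2) * ((Z $ 1 - P $ 1) * w $ 1 + (Z $ 2 - P $ 2) * w $ 2)"
    by (simp add: algebra_simps)
  moreover have "w $ 2 * ((Q $ 1 - P $ 1) * (Z $ 2 - P $ 2) - (Q $ 2 - P $ 2) * (Z $ 1 - P $ 1)) =
      (Q $ 1 - P $ 1) * ((Z $ 1 - P $ 1) * w $ 1 + (Z $ 2 - P $ 2) * w $ 2)
      - (Z $ 1 - P $ 1) * ((Q $ 1 - P $ 1) * w $ 1 + (Q $ 2 - P $ 2) * w $ 2)"
    by (simp add: algebra_simps)
  ultimately have "(Q $ 1 - P $ 1) * (Z $ 2 - P $ 2) = (Q $ 2 - P $ 2) * (Z $ 1 - P $ 1)"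
    unfolding eqs by auto
  thus ?thesis using collinear_if_cross_product_eq by blast
qed

section \<open>The Cayley--Menger relation and the effect of foldings on the diagonals\<close>

lemma gram_det_plane:
  fixes x1 x2 y1 y2 z1 z2 :: real
  defines "xx \<equiv> x1 * x1 + x2 * x2" and "yy \<equiv> y1 * y1 + y2 * y2" and "zz \<equiv> z1 * z1 + z2 * z2"
    and "xy \<equiv> x1 * y1 + x2 * y2" and "yz \<equiv> y1 * z1 + y2 * z2" and "xz \<equiv> x1 * z1 + x2 * z2"
  shows "xx * yy * zz + 2 * xy * yz * xz - xx * yz * yz - yy * xz * xz - zz * xy * xy = 0"
  unfolding assms by (simp add: algebra_simps)

fun diag_AC :: "quadrilateral \<Rightarrow> real" where
  "diag_AC (A, B, C, D) = (dist A C)\<^sup>2"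

fun diag_BD :: "quadrilateral \<Rightarrow> real" where
  "diag_BD (A, B, C, D) = (dist B D)\<^sup>2"

text \<open>The coefficients of the Cayley--Menger relation between the squared diagonals, see
  \<open>planar_relation\<close>.\<close>

definition side_sum :: "real ^ 4 \<Rightarrow> real" where
  "side_sum a = (a $ 1)\<^sup>2 + (a $ 2)\<^sup>2 + (a $ 3)\<^sup>2 + (a $ 4)\<^sup>2"

definition coeff_BD :: "real ^ 4 \<Rightarrow> real" where
  "coeff_BD a = ((a $ 1)\<^sup>2 - (a $ 2)\<^sup>2) * ((a $ 3)\<^sup>2 - (a $ 4)\<^sup>2)"

definition coeff_AC :: "real ^ 4 \<Rightarrow> real" where
  "coeff_AC a = ((a $ 2)\<^sup>2 - (a $ 3)\<^sup>2) * ((a $ 4)\<^sup>2 - (a $ 1)\<^sup>2)"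

definition coeff_0 :: "real ^ 4 \<Rightarrow> real" where
  "coeff_0 a = ((a $ 2)\<^sup>2 + (a $ 4)\<^sup>2 - (a $ 1)\<^sup>2 - (a $ 3)\<^sup>2) *
     ((a $ 1)\<^sup>2 * (a $ 3)\<^sup>2 - (a $ 2)\<^sup>2 * (a $ 4)\<^sup>2)"

text \<open>The law of cosines rewrites the Gram determinant of the vectors from \<open>A\<close> to
  \<open>B\<close>, \<open>C\<close> and \<open>D\<close> in squared distances; here
  \<open>yy\<close> and \<open>q\<close> are the squared diagonals.\<close>

lemma gram_det_dist_squares:
  fixes xx yy zz b c q :: real
  defines "xy \<equiv> (xx + yy - b) / 2" and "yz \<equiv> (yy + zz - c) / 2" and "xz \<equiv> (xx + zz - q) / 2"
  shows "4 * (xx * yy * zz + 2 * xy * yz * xz - xx * yz * yz - yy * xz * xz - zz * xy * xy) =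
    yy * q * (xx + b + c + zz - yy - q) + (xx - b) * (c - zz) * q + (b - c) * (zz - xx) * yy
    + (b + zz - xx - c) * (xx * c - b * zz)"
  unfolding assms by (simp add: field_simps)

lemma planar_relation:
  assumes "has_sides Q a"
  shows "diag_AC Q * diag_BD Q * (side_sum a - diag_AC Q - diag_BD Q)
    + coeff_BD a * diag_BD Q + coeff_AC a * diag_AC Q + coeff_0 a = 0"
proof -
  obtain A B C D where Q: "Q = (A, B, C, D)" by (cases Q)
  define x1 x2 y1 y2 z1 z2 where defs: "x1 = B $ 1 - A $ 1" "x2 = B $ 2 - A $ 2"
    "y1 = C $ 1 - A $ 1" "y2 = C $ 2 - A $ 2" "z1 = D $ 1 - A $ 1" "z2 = D $ 2 - A $ 2"
  have sides: "a $ 1 = dist A B" "a $ 2 = dist B C" "a $ 3 = dist C D" "a $ 4 = dist D A"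
    using assms by (simp_all add: Q)
  have xx: "x1 * x1 + x2 * x2 = (a $ 1)\<^sup>2" and yy: "y1 * y1 + y2 * y2 = diag_AC Q"
    and zz: "z1 * z1 + z2 * z2 = (a $ 4)\<^sup>2"
    unfolding sides Q diag_AC.simps dist_square_plane defs unfolding power2_eq_square by (simp_all add: algebra_simps)
  have xy: "x1 * y1 + x2 * y2 = ((a $ 1)\<^sup>2 + diag_AC Q - (a $ 2)\<^sup>2) / 2"
    and yz: "y1 * z1 + y2 * z2 = (diag_AC Q + (a $ 4)\<^sup>2 - (a $ 3)\<^sup>2) / 2"
    and xz: "x1 * z1 + x2 * z2 = ((a $ 1)\<^sup>2 + (a $ 4)\<^sup>2 - diag_BD Q) / 2"
    unfolding sides Q diag_AC.simps diag_BD.simps dist_square_plane defs unfolding power2_eq_square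
    by (simp_all add: field_simps)
  show ?thesis
    using gram_det_plane[of x1 x2 y1 y2 z1 z2] unfolding xx yy zz xy yz xz
    using gram_det_dist_squares[of "(a $ 1)\<^sup>2" "diag_AC Q" "(a $ 4)\<^sup>2" "(a $ 2)\<^sup>2" "(a $ 3)\<^sup>2" "diag_BD Q"]
    by (simp add: side_sum_def coeff_AC_def coeff_BD_def coeff_0_def)
qed

lemma fold_D_has_sides:
  assumes "has_sides Q a" and "fold_D Q = Some Q'"
  shows "has_sides Q' a" and "diag_AC Q' = diag_AC Q" and "diag_AC Q > 0"
    and "diag_AC Q * (diag_BD Q + diag_BD Q') = side_sum a * diag_AC Q - (diag_AC Q)\<^sup>2 + coeff_BD a"
proof -
  obtain A B C D where Q: "Q = (A, B, C, D)" by (cases Q)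
  have ne: "A \<noteq> C" and Q': "Q' = (A, B, C, reflect_line A C D)"
    using assms(2) by (auto simp: Q split: if_splits)
  have sides: "a $ 1 = dist A B" "a $ 2 = dist B C" "a $ 3 = dist C D" "a $ 4 = dist D A"
    using assms(1) by (simp_all add: Q)
  show "has_sides Q' a"
    using dist_reflect_line[OF ne, of D] by (simp add: Q' sides dist_commute)
  show "diag_AC Q' = diag_AC Q" "diag_AC Q > 0"
    using ne by (simp_all add: Q Q')
  show "diag_AC Q * (diag_BD Q + diag_BD Q') = side_sum a * diag_AC Q - (diag_AC Q)\<^sup>2 + coeff_BD a"
    using dist_reflect_line_sum[OF ne, of B D]
    unfolding Q Q' diag_AC.simps diag_BD.simps side_sum_def coeff_BD_def sides
      dist_commute[of C B] dist_commute[of D A]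
    by (simp add: algebra_simps power2_eq_square)
qed

lemma fold_C_has_sides:
  assumes "has_sides Q a" and "fold_C Q = Some Q'"
  shows "has_sides Q' a" and "diag_BD Q' = diag_BD Q" and "diag_BD Q > 0"
    and "diag_BD Q * (diag_AC Q + diag_AC Q') = side_sum a * diag_BD Q - (diag_BD Q)\<^sup>2 + coeff_AC a"
proof -
  obtain A B C D where Q: "Q = (A, B, C, D)" by (cases Q)
  have ne: "B \<noteq> D" and Q': "Q' = (A, B, reflect_line B D C, D)"
    using assms(2) by (auto simp: Q split: if_splits)
  have sides: "a $ 1 = dist A B" "a $ 2 = dist B C" "a $ 3 = dist C D" "a $ 4 = dist D A"
    using assms(1) by (simp_all add: Q)
  show "has_sides Q' a"
    using dist_reflect_line[OF ne, of C] by (simp add: Q' sides dist_commute)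
  show "diag_BD Q' = diag_BD Q" "diag_BD Q > 0"
    using ne by (simp_all add: Q Q')
  show "diag_BD Q * (diag_AC Q + diag_AC Q') = side_sum a * diag_BD Q - (diag_BD Q)\<^sup>2 + coeff_AC a"
    using dist_reflect_line_sum[OF ne, of A C]
    unfolding Q Q' diag_AC.simps diag_BD.simps side_sum_def coeff_AC_def sides
      dist_commute[of B A] dist_commute[of D C]
    by (simp add: algebra_simps power2_eq_square)
qed

lemma fold_CD_has_sides:
  assumes "has_sides Q a" and "fold_CD Q = Some Q'"
  shows "has_sides Q' a" and "diag_AC Q > 0" and "diag_BD Q' > 0"
    and "diag_AC Q * (diag_BD Q + diag_BD Q') = side_sum a * diag_AC Q - (diag_AC Q)\<^sup>2 + coeff_BD a"
    and "diag_BD Q' * (diag_AC Q + diag_AC Q') = side_sum a * diag_BD Q' - (diag_BD Q')\<^sup>2 + coeff_AC a"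
    and "diag_AC Q * diag_BD Q' * (side_sum a - diag_AC Q - diag_BD Q')
      + coeff_BD a * diag_BD Q' + coeff_AC a * diag_AC Q + coeff_0 a = 0"
proof -
  obtain Q1 where Q1: "fold_D Q = Some Q1" "fold_C Q1 = Some Q'"
    using assms(2) by (auto simp: fold_CD_def bind_eq_Some_conv)
  note D = fold_D_has_sides[OF assms(1) Q1(1)]
  note C = fold_C_has_sides[OF D(1) Q1(2)]
  show "has_sides Q' a" "diag_AC Q > 0" "diag_BD Q' > 0"
    using C D by simp_all
  show "diag_AC Q * (diag_BD Q + diag_BD Q') = side_sum a * diag_AC Q - (diag_AC Q)\<^sup>2 + coeff_BD a"
    using D(4) C(2) by simp
  show "diag_BD Q' * (diag_AC Q + diag_AC Q') = side_sum a * diag_BD Q' - (diag_BD Q')\<^sup>2 + coeff_AC a"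
    using C(4) unfolding C(2) D(2) .
  show "diag_AC Q * diag_BD Q' * (side_sum a - diag_AC Q - diag_BD Q')
      + coeff_BD a * diag_BD Q' + coeff_AC a * diag_AC Q + coeff_0 a = 0"
    using planar_relation[OF D(1)] unfolding C(2) D(2) .
qed

text \<open>\<open>A = C\<close> or \<open>B = D\<close> would make the sides equal in adjacent
  pairs, so the first factor of \<open>coeff_0\<close> would vanish.\<close>

lemma diag_pos_if_coeff_0_nonzero:
  assumes "has_sides Q a" and "coeff_0 a \<noteq> 0"
  shows "diag_AC Q > 0" and "diag_BD Q > 0"
proof -
  obtain A B C D where Q: "Q = (A, B, C, D)" by (cases Q)
  have sides: "a $ 1 = dist A B" "a $ 2 = dist B C" "a $ 3 = dist C D" "a $ 4 = dist D A"
    using assms(1) by (simp_all add: Q)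
  have "A \<noteq> C"
    using assms(2) by (auto simp: coeff_0_def sides dist_commute)
  moreover have "B \<noteq> D"
    using assms(2) by (auto simp: coeff_0_def sides dist_commute)
  ultimately show "diag_AC Q > 0" "diag_BD Q > 0"
    by (simp_all add: Q)
qed

lemma fold_CD_defined:
  assumes "has_sides Q a" and "coeff_0 a \<noteq> 0"
  obtains Q' where "fold_CD Q = Some Q'"
proof -
  obtain A B C D where Q: "Q = (A, B, C, D)" by (cases Q)
  have "A \<noteq> C"
    using diag_pos_if_coeff_0_nonzero(1)[OF assms] by (auto simp: Q)
  then obtain Q1 where Q1: "fold_D Q = Some Q1" by (simp add: Q)
  obtain A' B' C' D' where Q1': "Q1 = (A', B', C', D')" by (cases Q1)
  have "B' \<noteq> D'"
    using diag_pos_if_coeff_0_nonzero(2)[OF fold_D_has_sides(1)[OF assms(1) Q1] assms(2)]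
    by (auto simp: Q1')
  thus ?thesis using that Q1 by (simp add: fold_CD_def Q1')
qed

text \<open>An unchanged \<open>BD\<close> puts \<open>B\<close> or \<open>D\<close> on the line
  \<open>AC\<close>; an unchanged \<open>AC\<close> puts \<open>A\<close> or \<open>C\<close> on the
  line through \<open>B\<close> and the image of \<open>D\<close>. Since no side has length zero,
  these lines coincide.\<close>

lemma collinear_if_fold_CD_fixes_diagonals:
  assumes "has_sides Q a" and pos: "\<And>i. a $ i > 0" and "fold_CD Q = Some Q'"
    and "diag_AC Q' = diag_AC Q" and "diag_BD Q' = diag_BD Q"
  shows "collinear_quad Q"
proof -
  obtain A B C D where Q: "Q = (A, B, C, D)" by (cases Q)
  obtain Q1 where Q1: "fold_D Q = Some Q1" "fold_C Q1 = Some Q'"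
    using assms(3) by (auto simp: fold_CD_def bind_eq_Some_conv)
  define D' where "D' = reflect_line A C D"
  define C' where "C' = reflect_line B D' C"
  have AC: "A \<noteq> C" and Q1_eq: "Q1 = (A, B, C, D')"
    using Q1(1) by (auto simp: Q D'_def split: if_splits)
  have BD: "B \<noteq> D'" and Q': "Q' = (A, B, C', D')"
    using Q1(2) by (auto simp: Q1_eq C'_def split: if_splits)
  have ne: "A \<noteq> B" "B \<noteq> C" "C \<noteq> D" "D \<noteq> A"
    using assms(1) pos[of 1] pos[of 2] pos[of 3] pos[of 4] by (auto simp: Q)
  have "dist B D' = dist B D" "dist A C' = dist A C"
    using assms(4,5) by (simp_all add: Q Q')
  hence 1: "collinear {A, C, D} \<or> collinear {A, C, B}"
    and 2: "collinear {B, D', C} \<or> collinear {B, D', A}"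
    using collinear_if_dist_reflect_line_eq AC BD unfolding D'_def C'_def by blast+
  have base: "collinear {A, B, C, D}"
    if "X \<noteq> Y" "collinear {X, Y, Z}" "collinear {X, Y, W}" "{A, B, C, D} \<subseteq> {X, Y, Z, W}" for X Y Z W
    using that collinear_4_3[of X Y Z W] collinear_subset by blast
  show ?thesis
  proof (cases "collinear {A, C, D}")
    case True
    hence "D' = D" unfolding D'_def by (rule reflect_line_fixed[OF AC])
    with 2 show ?thesis
      using base[of C D A B] base[of D A C B] True ne by (auto simp: Q insert_commute)
  next
    case False
    with 1 have ACB: "collinear {A, C, B}" by blast
    have "collinear {A, B, C, D'}"
      using 2
    proof
      assume "collinear {B, D', C}"
      thus ?thesis
        using collinear_4_3[of B C A D'] ne ACB by (simp add: insert_commute)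
    next
      assume "collinear {B, D', A}"
      thus ?thesis
        using collinear_4_3[of A B C D'] ne ACB by (simp add: insert_commute)
    qed
    hence "collinear {A, C, D'}"
      by (rule collinear_subset) auto
    hence "collinear {A, C, D}"
      unfolding D'_def by (rule collinear_if_collinear_reflect_line[OF AC])
    with False show ?thesis by blast
  qed
qed

section \<open>Congruence and existence of plane quadrilaterals\<close>

lemma plane_congruence:
  fixes A B C D A' B' C' D' :: "real ^ 2"
  assumes "A \<noteq> C" and AB: "dist A' B' = dist A B" and BC: "dist B' C' = dist B C"
    and CD: "dist C' D' = dist C D" and DA: "dist D' A' = dist D A"
    and AC: "dist A' C' = dist A C" and BD: "dist B' D' = dist B D"
  shows "\<exists>f :: real ^ 2 \<Rightarrow> real ^ 2. (\<forall>x y. dist (f x) (f y) = dist x y) \<and>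
    f A = A' \<and> f B = B' \<and> f C = C' \<and> f D = D'"
proof -
  define e1 e2 e1' e2' where e: "e1 = C $ 1 - A $ 1" "e2 = C $ 2 - A $ 2"
    "e1' = C' $ 1 - A' $ 1" "e2' = C' $ 2 - A' $ 2"
  define r where "r = (dist A C)\<^sup>2"
  have r: "r = e1\<^sup>2 + e2\<^sup>2" and r': "r = e1'\<^sup>2 + e2'\<^sup>2"
    using dist_square_plane[of C A] dist_square_plane[of C' A'] AC
    by (simp_all add: r_def e dist_commute)
  have "r > 0" using assms(1) by (simp add: r_def)
  \<comment> \<open>Coordinates along and across \<open>AC\<close>, scaled by its length. Distances
    determine \<open>u\<close> and the products of values of \<open>w\<close>.\<close>
  define u where "u X = (X $ 1 - A $ 1) * e1 + (X $ 2 - A $ 2) * e2" for X :: "real ^ 2"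
  define w where "w X = (X $ 2 - A $ 2) * e1 - (X $ 1 - A $ 1) * e2" for X :: "real ^ 2"
  define u' where "u' X = (X $ 1 - A' $ 1) * e1' + (X $ 2 - A' $ 2) * e2'" for X :: "real ^ 2"
  define w' where "w' X = (X $ 2 - A' $ 2) * e1' - (X $ 1 - A' $ 1) * e2'" for X :: "real ^ 2"
  have u_dist: "2 * u X = (dist A X)\<^sup>2 + r - (dist X C)\<^sup>2" for X
    unfolding r dist_square_plane u_def e by (simp add: power2_eq_square algebra_simps)
  have u'_dist: "2 * u' X = (dist A' X)\<^sup>2 + r - (dist X C')\<^sup>2" for X
    unfolding r' dist_square_plane u'_def e by (simp add: power2_eq_square algebra_simps)
  have uw: "2 * (u X * u Y + w X * w Y) = r * ((dist A X)\<^sup>2 + (dist A Y)\<^sup>2 - (dist X Y)\<^sup>2)" for X Y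
    unfolding r dist_square_plane u_def w_def by (simp add: power2_eq_square algebra_simps)
  have uw': "2 * (u' X * u' Y + w' X * w' Y) = r * ((dist A' X)\<^sup>2 + (dist A' Y)\<^sup>2 - (dist X Y)\<^sup>2)" for X Y
    unfolding r' dist_square_plane u'_def w'_def by (simp add: power2_eq_square algebra_simps)
  have uB: "u' B' = u B" and uD: "u' D' = u D"
    using u_dist[of B] u'_dist[of B'] u_dist[of D] u'_dist[of D'] AB BC CD DA
    by (simp_all add: dist_commute)
  have wBB: "w' B' * w' B' = w B * w B"
    using uw[of B B] uw'[of B' B'] uB AB by simp
  have wDD: "w' D' * w' D' = w D * w D"
    using uw[of D D] uw'[of D' D'] uD DA by (simp add: dist_commute)
  have wBD: "w' B' * w' D' = w B * w D"
    using uw[of B D] uw'[of B' D'] uB uD AB DA BD by (simp add: dist_commute)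
  \<comment> \<open>The heights of \<open>B\<close> and \<open>D\<close> over \<open>AC\<close>
    agree up to a common sign \<open>t\<close>, which decides whether the isometry reverses
    orientation.\<close>
  obtain t :: real where t: "t * t = 1" "w' B' = t * w B" "w' D' = t * w D"
  proof (cases "w B = 0")
    case True
    moreover from this wBB have "w' B' = 0" by simp
    moreover from wDD have "w' D' = w D \<or> w' D' = - w D"
      by (simp add: square_eq_iff)
    ultimately show ?thesis using that[of 1] that[of "- 1"] by auto
  next
    case False
    from wBB consider "w' B' = w B" | "w' B' = - w B"
      by (auto simp: square_eq_iff)
    thus ?thesis
    proof cases
      case 1
      with wBD False show ?thesis using that[of 1] by simp
    next
      case 2
      with wBD have "w B * (w' D' + w D) = 0" by (simp add: algebra_simps)
      with False 2 show ?thesis using that[of "- 1"] by auto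
    qed
  qed
  define f :: "real ^ 2 \<Rightarrow> real ^ 2" where
    "f X = vector [A' $ 1 + (u X * e1' - t * w X * e2') / r, A' $ 2 + (u X * e2' + t * w X * e1') / r]" for X
  have f1: "f X $ 1 = A' $ 1 + (u X * e1' - t * w X * e2') / r"
    and f2: "f X $ 2 = A' $ 2 + (u X * e2' + t * w X * e1') / r" for X
    by (simp_all add: f_def)
  have "(dist (f X) (f Y))\<^sup>2 = (dist X Y)\<^sup>2" for X Y
  proof -
    have "r * r * (dist (f X) (f Y))\<^sup>2 =
        (r * (f X $ 1 - f Y $ 1))\<^sup>2 + (r * (f X $ 2 - f Y $ 2))\<^sup>2"
      unfolding dist_square_plane by (simp add: power_mult_distrib power2_eq_square algebra_simps)
    also have "r * (f X $ 1 - f Y $ 1) = (u X - u Y) * e1' - t * (w X - w Y) * e2'"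
      using \<open>r > 0\<close> by (simp add: f1 field_simps)
    also have "r * (f X $ 2 - f Y $ 2) = (u X - u Y) * e2' + t * (w X - w Y) * e1'"
      using \<open>r > 0\<close> by (simp add: f2 field_simps)
    also have "((u X - u Y) * e1' - t * (w X - w Y) * e2')\<^sup>2 + ((u X - u Y) * e2' + t * (w X - w Y) * e1')\<^sup>2 =
        ((u X - u Y)\<^sup>2 + (t * t) * (w X - w Y)\<^sup>2) * r"
      unfolding r' by (simp add: power2_eq_square algebra_simps)
    also have "(u X - u Y)\<^sup>2 + (t * t) * (w X - w Y)\<^sup>2 = r * (dist X Y)\<^sup>2"
      unfolding t(1) r dist_square_plane u_def w_def by (simp add: power2_eq_square algebra_simps)
    finally show ?thesis using \<open>r > 0\<close> by simp
  qed
  hence "\<forall>x y. dist (f x) (f y) = dist x y" by simp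
  moreover have f_eqI: "f X = X'" if "u' X' = u X" "w' X' = t * w X" for X X'
  proof -
    have "u X * e1' - t * w X * e2' = (X' $ 1 - A' $ 1) * r"
      unfolding that [symmetric] r' u'_def w'_def by (simp add: power2_eq_square algebra_simps)
    moreover have "u X * e2' + t * w X * e1' = (X' $ 2 - A' $ 2) * r"
      unfolding that [symmetric] r' u'_def w'_def by (simp add: power2_eq_square algebra_simps)
    ultimately show ?thesis
      using \<open>r > 0\<close> by (simp add: Finite_Cartesian_Product.vec_eq_iff forall_2 f1 f2)
  qed
  have "f A = A'"
    by (rule f_eqI) (simp_all add: u_def w_def u'_def w'_def)
  moreover have "u' C' = u C" "w' C' = 0" "w C = 0"
    using r r' by (simp_all add: u_def u'_def w_def w'_def e power2_eq_square)
  hence "f C = C'" by (intro f_eqI) simp_all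
  moreover have "f B = B'" "f D = D'"
    using f_eqI uB uD t(2,3) by blast+
  ultimately show ?thesis by blast
qed

lemma congruent_quad_iff:
  assumes "has_sides Q a" and "has_sides Q' a" and "diag_AC Q > 0"
  shows "congruent_quad Q Q' \<longleftrightarrow> diag_AC Q' = diag_AC Q \<and> diag_BD Q' = diag_BD Q"
proof -
  obtain A B C D where Q: "Q = (A, B, C, D)" by (cases Q)
  obtain A' B' C' D' where Q': "Q' = (A', B', C', D')" by (cases Q')
  show ?thesis
  proof
    assume "congruent_quad Q Q'"
    thus "diag_AC Q' = diag_AC Q \<and> diag_BD Q' = diag_BD Q"
      by (auto simp: Q)
  next
    assume *: "diag_AC Q' = diag_AC Q \<and> diag_BD Q' = diag_BD Q"
    have "A \<noteq> C" using assms(3) by (auto simp: Q)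
    from plane_congruence[OF this, of A' B' B C' D' D]
    show "congruent_quad Q Q'"
      using assms(1,2) * by (auto simp: Q Q' eq_commute[of A'] eq_commute[of B'] eq_commute[of C'] eq_commute[of D'])
  qed
qed

lemma triangle_exists:
  fixes r b c :: real
  assumes "r > 0" and "b > 0" and "c > 0" and "\<bar>b - c\<bar> < r" and "r < b + c"
  obtains x h where "h > 0" and "x\<^sup>2 + h\<^sup>2 = b\<^sup>2" and "(x - r)\<^sup>2 + h\<^sup>2 = c\<^sup>2"
proof -
  \<comment> \<open>The foot of the altitude, by the law of cosines; the triangle inequalities place
    it strictly between \<open>- b\<close> and \<open>b\<close>.\<close>
  define x where "x = (b\<^sup>2 + r\<^sup>2 - c\<^sup>2) / (2 * r)"
  have rx: "2 * r * x = b\<^sup>2 + r\<^sup>2 - c\<^sup>2" using assms(1) by (simp add: x_def)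
  have "(b + r - c) * (b + r + c) > 0"
    using assms by (intro mult_pos_pos) auto
  also have "(b + r - c) * (b + r + c) = (b + x) * (2 * r)"
    using rx by (simp add: power2_eq_square algebra_simps)
  finally have 1: "b + x > 0"
    by (rule zero_less_mult_pos2) (use assms(1) in simp)
  have "(c - r + b) * (c + r - b) > 0"
    using assms by (intro mult_pos_pos) auto
  also have "(c - r + b) * (c + r - b) = (b - x) * (2 * r)"
    using rx by (simp add: power2_eq_square algebra_simps)
  finally have 2: "b - x > 0"
    by (rule zero_less_mult_pos2) (use assms(1) in simp)
  define h where "h = sqrt (b\<^sup>2 - x\<^sup>2)"
  have "b\<^sup>2 - x\<^sup>2 = (b + x) * (b - x)" by (simp add: power2_eq_square algebra_simps)
  also have "\<dots> > 0" using 1 2 by (rule mult_pos_pos)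
  finally have pos: "b\<^sup>2 - x\<^sup>2 > 0" .
  hence h: "h > 0" "x\<^sup>2 + h\<^sup>2 = b\<^sup>2" by (simp_all add: h_def)
  moreover have "(x - r)\<^sup>2 + h\<^sup>2 = c\<^sup>2"
    using h(2) rx by (simp add: power2_eq_square algebra_simps)
  ultimately show ?thesis using that by blast
qed

lemma admissible_sides_pos: "admissible_sides a \<Longrightarrow> a $ i > 0"
  by (simp add: admissible_sides_def)

lemma noncollinear_quad_exists:
  assumes "admissible_sides a"
  obtains Q where "has_sides Q a" and "\<not> collinear_quad Q"
proof -
  have sum: "(\<Sum>j\<in>UNIV - {i}. a $ j) = a $ 1 + a $ 2 + a $ 3 + a $ 4 - a $ i" for i
    by (simp add: sum_diff1 sum_4)
  have pos: "a $ i > 0" and less: "2 * a $ i < a $ 1 + a $ 2 + a $ 3 + a $ 4" for i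
    using assms unfolding admissible_sides_def sum by (auto dest: spec[of _ i])
  define lo where "lo = max \<bar>a $ 1 - a $ 2\<bar> \<bar>a $ 4 - a $ 3\<bar>"
  define hi where "hi = min (a $ 1 + a $ 2) (a $ 4 + a $ 3)"
  \<comment> \<open>A diagonal of length strictly between \<open>lo\<close> and \<open>hi\<close>
    carries nondegenerate triangles over both pairs of sides; the inequalities for the sides leave
    room for one.\<close>
  have "lo < hi"
    using less[of 1] less[of 2] less[of 3] less[of 4] pos[of 1] pos[of 2] pos[of 3] pos[of 4]
    unfolding lo_def hi_def by (auto simp: max_def min_def abs_if)
  define r where "r = (lo + hi) / 2"
  have r: "lo < r" "r < hi" using \<open>lo < hi\<close> by (simp_all add: r_def)
  have "r > 0" using r(1) by (auto simp: lo_def)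
  have tri: "\<bar>a $ 1 - a $ 2\<bar> < r" "r < a $ 1 + a $ 2" "\<bar>a $ 4 - a $ 3\<bar> < r" "r < a $ 4 + a $ 3"
    using r by (auto simp: lo_def hi_def)
  obtain x h where xh: "h > 0" "x\<^sup>2 + h\<^sup>2 = (a $ 1)\<^sup>2" "(x - r)\<^sup>2 + h\<^sup>2 = (a $ 2)\<^sup>2"
    by (rule triangle_exists[OF \<open>r > 0\<close> pos pos tri(1,2)])
  obtain y k where yk: "k > 0" "y\<^sup>2 + k\<^sup>2 = (a $ 4)\<^sup>2" "(y - r)\<^sup>2 + k\<^sup>2 = (a $ 3)\<^sup>2"
    by (rule triangle_exists[OF \<open>r > 0\<close> pos pos tri(3,4)])
  define A B C D :: "real ^ 2" where
    ABCD: "A = 0" "B = vector [x, h]" "C = vector [r, 0]" "D = vector [y, k]"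
  have "(dist A B)\<^sup>2 = (a $ 1)\<^sup>2" "(dist B C)\<^sup>2 = (a $ 2)\<^sup>2" "(dist C D)\<^sup>2 = (a $ 3)\<^sup>2" "(dist D A)\<^sup>2 = (a $ 4)\<^sup>2"
    using xh yk unfolding dist_square_plane ABCD by (simp_all add: power2_commute[of r])
  hence "has_sides (A, B, C, D) a"
    using pos by (simp add: less_imp_le)
  moreover have "\<not> collinear {A, B, C, D}"
  proof
    assume "collinear {A, B, C, D}"
    hence "collinear {A, C, B}" by (rule collinear_subset) auto
    hence "B = 0 \<or> C = 0 \<or> (\<exists>c. B = c *\<^sub>R C)"
      unfolding ABCD(1) collinear_lemma by blast
    thus False
      using xh(1) \<open>r > 0\<close> by (auto simp: ABCD Finite_Cartesian_Product.vec_eq_iff forall_2)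
  qed
  ultimately show ?thesis using that[of "(A, B, C, D)"] by simp
qed

section \<open>The radicand and the periodicity criterion\<close>

lemma delta_conj_sides:
  "delta_sides (conj_sides a) = ((a $ 2)\<^sup>2 + (a $ 4)\<^sup>2 - (a $ 1)\<^sup>2 - (a $ 3)\<^sup>2) / 2"
  by (simp add: delta_sides_def conj_sides_def power2_eq_square field_simps)

text \<open>So \<open>coeff_0 a / 2\<close> is the constant \<open>t\<close>, and the degenerate
  case is \<open>coeff_0 a = 0\<close>.\<close>

lemma coeff_0_eq: "coeff_0 a = 2 * Delta_sides a * delta_sides a * delta_sides (conj_sides a)"
  unfolding delta_conj_sides
  by (simp add: coeff_0_def Delta_sides_def delta_sides_def power2_eq_square field_simps)

lemma sum_of_squares_eq:
  "(Delta_sides a)\<^sup>2 + (delta_sides a)\<^sup>2 + (delta_sides (conj_sides a))\<^sup>2 =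
    (side_sum a)\<^sup>2 / 4 + coeff_BD a + coeff_AC a"
  unfolding delta_conj_sides
  by (simp add: Delta_sides_def delta_sides_def side_sum_def coeff_BD_def coeff_AC_def
      power2_eq_square field_simps)

lemma sum_of_products_of_squares_eq:
  "(Delta_sides a)\<^sup>2 * (delta_sides a)\<^sup>2 + (Delta_sides a)\<^sup>2 * (delta_sides (conj_sides a))\<^sup>2
     + (delta_sides a)\<^sup>2 * (delta_sides (conj_sides a))\<^sup>2 =
    coeff_BD a * coeff_AC a - coeff_0 a * side_sum a / 2"
  unfolding delta_conj_sides
  by (simp add: Delta_sides_def delta_sides_def side_sum_def coeff_BD_def coeff_AC_def coeff_0_def
      power2_eq_square field_simps)

lemma radicand_eq_diagonal_cubic:
  "radicand a = - fps_of_poly (diagonal_cubic (side_sum a) (coeff_BD a) (coeff_AC a) (coeff_0 a))"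
proof -
  let ?x = "(Delta_sides a)\<^sup>2" and ?y = "(delta_sides a)\<^sup>2" and ?z = "(delta_sides (conj_sides a))\<^sup>2"
  have "radicand a = fps_of_poly ([:- of_real ?x, 1:] * [:- of_real ?y, 1:] * [:- of_real ?z, 1:])"
    unfolding fps_of_poly_mult fps_of_poly_linear radicand_def by simp
  also have "[:- of_real ?x, 1:] * [:- of_real ?y, 1:] * [:- of_real ?z, 1:] =
      - [:of_real (?x * ?y * ?z), of_real (- (?x * ?y + ?x * ?z + ?y * ?z)), of_real (?x + ?y + ?z), - 1 :: complex:]"
    by (simp add: algebra_simps)
  also have "?x * ?y * ?z = (coeff_0 a / 2)\<^sup>2"
    by (simp add: coeff_0_eq power_mult_distrib)
  finally show ?thesis
    unfolding sum_of_squares_eq sum_of_products_of_squares_eq diagonal_cubic_def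
    by (simp add: fps_of_poly_uminus)
qed

lemma degree_diagonal_cubic: "degree (diagonal_cubic s k l c) = 3"
  by (simp add: diagonal_cubic_def)

text \<open>Both \<open>\<i>\<close> and \<open>- \<i>\<close> turn \<open>S\<close> into a root of
  the cubic, with opposite constant terms; one of them has the required sign.\<close>

lemma sqrt_expansion_normalize:
  assumes "sqrt_expansion a S"
  obtains u where "u \<noteq> 0"
    and "(fps_const u * S)\<^sup>2 = fps_of_poly (diagonal_cubic (side_sum a) (coeff_BD a) (coeff_AC a) (coeff_0 a))"
    and "fps_nth (fps_const u * S) 0 = of_real (coeff_0 a / 2)"
proof -
  let ?g = "diagonal_cubic (side_sum a) (coeff_BD a) (coeff_AC a) (coeff_0 a)"
  have S: "S\<^sup>2 = - fps_of_poly ?g"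
    using assms by (simp add: sqrt_expansion_def radicand_eq_diagonal_cubic)
  have sq: "(fps_const u * S)\<^sup>2 = fps_of_poly ?g" if "u\<^sup>2 = - 1" for u
    using that by (simp add: power_mult_distrib S fps_const_power)
  have "(\<i> * fps_nth S 0)\<^sup>2 = fps_nth ((fps_const \<i> * S)\<^sup>2) 0"
    by (simp add: power2_eq_square)
  also have "\<dots> = (of_real (coeff_0 a / 2))\<^sup>2"
    by (subst sq) (simp_all add: diagonal_cubic_def)
  finally have "\<i> * fps_nth S 0 = of_real (coeff_0 a / 2) \<or> - \<i> * fps_nth S 0 = of_real (coeff_0 a / 2)"
    unfolding power2_eq_iff by auto
  thus ?thesis
    using that[of "\<i>"] that[of "- \<i>"] sq[of "\<i>"] sq[of "- \<i>"] by auto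
qed

text \<open>A vanishing constant term of \<open>S\<close> also removes the linear term of the
  radicand, a sum of nonnegative products. As \<open>Delta_sides a > 0\<close>, both deltas vanish,
  so the pairs of opposite sides have equal sum and product.\<close>

lemma kite_if_coeff_0_eq_0:
  assumes "\<And>i. a $ i > 0" and "sqrt_expansion a S" and "coeff_0 a = 0"
  shows "a $ 1 = a $ 2 \<and> a $ 3 = a $ 4 \<or> a $ 1 = a $ 4 \<and> a $ 2 = a $ 3"
proof -
  let ?x = "(Delta_sides a)\<^sup>2" and ?y = "(delta_sides a)\<^sup>2" and ?z = "(delta_sides (conj_sides a))\<^sup>2"
  let ?g = "diagonal_cubic (side_sum a) (coeff_BD a) (coeff_AC a) (coeff_0 a)"
  have S: "S\<^sup>2 = - fps_of_poly ?g"
    using assms(2) by (simp add: sqrt_expansion_def radicand_eq_diagonal_cubic)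
  have "(fps_nth S 0)\<^sup>2 = fps_nth (S\<^sup>2) 0"
    by (simp add: power2_eq_square)
  also have "\<dots> = 0"
    unfolding S by (simp add: diagonal_cubic_def assms(3))
  finally have "fps_nth S 0 = 0" by simp
  hence "fps_nth (S\<^sup>2) 1 = 0"
    by (simp add: power2_eq_square fps_mult_nth_1)
  hence "complex_of_real (coeff_0 a * side_sum a / 2 - coeff_BD a * coeff_AC a) = 0"
    unfolding S by (simp add: diagonal_cubic_def)
  hence "?x * ?y + ?x * ?z + ?y * ?z = 0"
    unfolding sum_of_products_of_squares_eq of_real_eq_0_iff by simp
  moreover have "?x * ?y \<ge> 0" "?x * ?z \<ge> 0" "?y * ?z \<ge> 0" by simp_all
  ultimately have "?x * ?y = 0" "?x * ?z = 0" by linarith+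
  moreover have "Delta_sides a > 0"
    using assms(1) by (simp add: Delta_sides_def add_pos_pos)
  ultimately have "delta_sides a = 0" "delta_sides (conj_sides a) = 0"
    by simp_all
  hence prod: "a $ 1 * a $ 3 = a $ 2 * a $ 4" and squares: "(a $ 1)\<^sup>2 + (a $ 3)\<^sup>2 = (a $ 2)\<^sup>2 + (a $ 4)\<^sup>2"
    unfolding delta_conj_sides by (simp_all add: delta_sides_def)
  have "(a $ 1 + a $ 3)\<^sup>2 = (a $ 2 + a $ 4)\<^sup>2"
    using prod squares by (simp add: power2_sum)
  hence "a $ 1 + a $ 3 = a $ 2 + a $ 4"
    using assms(1)[of 1] assms(1)[of 2] assms(1)[of 3] assms(1)[of 4]
    by (simp add: power2_eq_iff)
  from sum_product_eq_cases[OF this prod] show ?thesis by auto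
qed

section \<open>Iterated foldings and the two cases of the criterion\<close>

lemma iterate_fold_CD_0: "iterate_fold_CD 0 Q = Some Q"
  by (simp add: iterate_fold_CD_def)

lemma iterate_fold_CD_Suc: "iterate_fold_CD (Suc n) Q = Option.bind (iterate_fold_CD n Q) fold_CD"
  by (simp add: iterate_fold_CD_def)

lemma iterate_fold_CD_has_sides:
  assumes "has_sides Q a" and "iterate_fold_CD n Q = Some Q'"
  shows "has_sides Q' a"
  using assms(2)
proof (induction n arbitrary: Q')
  case (Suc n)
  from Suc.prems obtain Q'' where "iterate_fold_CD n Q = Some Q''" "fold_CD Q'' = Some Q'"
    by (auto simp: iterate_fold_CD_Suc bind_eq_Some_conv)
  thus ?case using Suc.IH fold_CD_has_sides(1) by blast
qed (use assms(1) in \<open>simp add: iterate_fold_CD_0\<close>)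

lemma fold_CD_defined_if_iterate:
  assumes "iterate_fold_CD (Suc n) Q = Some Q'"
  obtains Q1 where "fold_CD Q = Some Q1"
proof -
  have "\<exists>Q1. fold_CD Q = Some Q1"
    using assms
  proof (induction n arbitrary: Q')
    case 0
    hence "fold_CD Q = Some Q'" by (simp add: iterate_fold_CD_Suc iterate_fold_CD_0)
    thus ?case by blast
  next
    case (Suc n)
    from Suc.prems obtain Q'' where "iterate_fold_CD (Suc n) Q = Some Q''"
      by (subst (asm) iterate_fold_CD_Suc) (auto simp: bind_eq_Some_conv)
    thus ?case by (rule Suc.IH)
  qed
  thus ?thesis using that by blast
qed

text \<open>For one kind of kite the product of the two roots \<open>p\<close> is zero, so the last
  folding of \<open>C\<close> ends in \<open>A = C\<close>; for the other the product of the roots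
  \<open>q\<close> is zero, so \<open>B = D\<close> at the start. Congruence of start and end
  contradicts the definedness of the foldings.\<close>

lemma kite_not_periodic:
  assumes "has_sides Q a" and "n \<ge> 1" and "coeff_0 a = 0"
    and kite: "a $ 1 = a $ 2 \<and> a $ 3 = a $ 4 \<or> a $ 1 = a $ 4 \<and> a $ 2 = a $ 3"
  shows "\<not> periodic_disregarding_orientation n Q"
proof
  assume "periodic_disregarding_orientation n Q"
  then obtain Q' where Q': "iterate_fold_CD n Q = Some Q'" "congruent_quad Q Q'"
    by (auto simp: periodic_disregarding_orientation_def)
  from assms(2) obtain k where n: "n = Suc k" by (cases n) auto
  obtain Q1 where Q1: "fold_CD Q = Some Q1"
    using fold_CD_defined_if_iterate Q'(1) unfolding n by blast
  obtain Q2 where Q2: "iterate_fold_CD k Q = Some Q2" "fold_CD Q2 = Some Q'"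
    using Q'(1) by (auto simp: n iterate_fold_CD_Suc bind_eq_Some_conv)
  note F1 = fold_CD_has_sides[OF assms(1) Q1]
  note F2 = fold_CD_has_sides[OF iterate_fold_CD_has_sides[OF assms(1) Q2(1)] Q2(2)]
  have eq: "diag_AC Q' = diag_AC Q" "diag_BD Q' = diag_BD Q"
    using Q'(2) congruent_quad_iff[OF assms(1) F2(1) F1(2)] by simp_all
  from kite show False
  proof
    assume "a $ 1 = a $ 2 \<and> a $ 3 = a $ 4"
    hence BD: "coeff_BD a = 0" by (simp add: coeff_BD_def)
    have "diag_BD Q' * (diag_BD Q' * diag_AC Q') = 0"
    proof -
      have "diag_AC Q2 * (diag_BD Q' * (diag_AC Q2 + diag_AC Q')) =
          diag_AC Q2 * (side_sum a * diag_BD Q' - (diag_BD Q')\<^sup>2 + coeff_AC a)"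
        unfolding F2(5) ..
      hence "diag_AC Q2 * (diag_BD Q' * diag_AC Q') = 0"
        using F2(6) unfolding BD assms(3) by (simp add: algebra_simps power2_eq_square)
      thus ?thesis using F2(2) by simp
    qed
    hence "diag_AC Q' = 0" using F2(3) by simp
    thus False using F1(2) eq(1) by simp
  next
    assume "a $ 1 = a $ 4 \<and> a $ 2 = a $ 3"
    hence AC: "coeff_AC a = 0" by (simp add: coeff_AC_def)
    have "diag_BD Q * (diag_AC Q * (diag_BD Q + diag_BD Q1)) =
        diag_BD Q * (side_sum a * diag_AC Q - (diag_AC Q)\<^sup>2 + coeff_BD a)"
      unfolding F1(4) ..
    hence "diag_BD Q * (diag_AC Q * diag_BD Q1) = 0"
      using planar_relation[OF assms(1)] unfolding AC assms(3)
      by (simp add: algebra_simps power2_eq_square)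
    hence "diag_BD Q = 0" using F1(2,3) by simp
    thus False using F2(3) eq(2) by simp
  qed
qed

lemma not_period_condition_if_coeff_0_eq_0:
  assumes "sqrt_expansion a S" and "n \<ge> 1" and "coeff_0 a = 0"
  shows "\<not> period_condition S n"
proof -
  obtain u where u: "u \<noteq> 0"
    "(fps_const u * S)\<^sup>2 = fps_of_poly (diagonal_cubic (side_sum a) (coeff_BD a) (coeff_AC a) (coeff_0 a))"
    "fps_nth (fps_const u * S) 0 = of_real (coeff_0 a / 2)"
    using assms(1) by (rule sqrt_expansion_normalize)
  have "\<not> pade_relation n (fps_const u * S) P Q" for P Q
    using u(3) assms(2,3)
    by (intro no_pade_relation_if_vanishing[OF u(2) degree_diagonal_cubic]) simp_all
  thus ?thesis
    using period_condition_iff_pade[OF assms(2), of "fps_const u * S"]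
      period_condition_scale[OF assms(2) u(1), of S] by blast
qed

text \<open>A nonzero \<open>coeff_0 a\<close> keeps both diagonals positive, so the orbit never
  stops; congruence along it amounts to the return of both diagonals.\<close>

lemma periodic_iff_period_condition:
  assumes "\<And>i. a $ i > 0" and "n \<ge> 1" and "sqrt_expansion a S" and c: "coeff_0 a \<noteq> 0"
    and "has_sides Q a" and "\<not> collinear_quad Q"
  shows "periodic_disregarding_orientation n Q \<longleftrightarrow> period_condition S n"
proof -
  obtain u where u: "u \<noteq> 0"
    "(fps_const u * S)\<^sup>2 = fps_of_poly (diagonal_cubic (side_sum a) (coeff_BD a) (coeff_AC a) (coeff_0 a))"
    "fps_nth (fps_const u * S) 0 = of_real (coeff_0 a / 2)"
    using assms(3) by (rule sqrt_expansion_normalize)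
  define orbit where "orbit j = the (iterate_fold_CD j Q)" for j
  have orbit: "iterate_fold_CD j Q = Some (orbit j) \<and> has_sides (orbit j) a" for j
  proof (induction j)
    case 0
    show ?case using assms(5) by (simp add: orbit_def iterate_fold_CD_0)
  next
    case (Suc j)
    then obtain Q' where "fold_CD (orbit j) = Some Q'"
      using fold_CD_defined c by blast
    hence "iterate_fold_CD (Suc j) Q = Some Q'"
      using Suc by (simp add: iterate_fold_CD_Suc)
    thus ?case
      using iterate_fold_CD_has_sides[OF assms(5)] by (simp add: orbit_def)
  qed
  have orbit_0: "orbit 0 = Q" by (simp add: orbit_def iterate_fold_CD_0)
  have step: "fold_CD (orbit j) = Some (orbit (Suc j))" for j
    using orbit[of j] orbit[of "Suc j"] by (simp add: iterate_fold_CD_Suc)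
  have sides: "has_sides (orbit j) a" for j using orbit by blast
  interpret diagonal_sequence "\<lambda>j. diag_AC (orbit j)" "\<lambda>j. diag_BD (orbit j)"
    "side_sum a" "coeff_BD a" "coeff_AC a" "coeff_0 a"
  proof
    fix j
    show "diag_AC (orbit j) > 0" "diag_BD (orbit j) > 0"
      using diag_pos_if_coeff_0_nonzero[OF sides c] by auto
  qed (use planar_relation[OF sides] fold_CD_has_sides(4,5)[OF sides step] in auto)
  \<comment> \<open>Noncollinearity rules out a stationary orbit, whose return would carry no
    information on \<open>n\<close>.\<close>
  have moving: "\<not> (diag_BD (orbit 1) = diag_BD (orbit 0) \<and> diag_AC (orbit 1) = diag_AC (orbit 0))"
    using collinear_if_fold_CD_fixes_diagonals[OF assms(5,1)] assms(6) step[of 0] by (auto simp: orbit_0)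
  have "periodic_disregarding_orientation n Q \<longleftrightarrow> congruent_quad Q (orbit n)"
    using orbit[of n] by (simp add: periodic_disregarding_orientation_def)
  also have "\<dots> \<longleftrightarrow> diag_AC (orbit n) = diag_AC (orbit 0) \<and> diag_BD (orbit n) = diag_BD (orbit 0)"
    using congruent_quad_iff[OF assms(5) sides] diag_pos_if_coeff_0_nonzero(1)[OF assms(5) c]
    by (simp add: orbit_0)
  also have "\<dots> \<longleftrightarrow> period_condition (fps_const u * S) n"
    by (rule period_condition_iff_returns[OF c u(2,3) assms(2) moving, symmetric])
  also have "\<dots> \<longleftrightarrow> period_condition S n"
    by (rule period_condition_scale[OF assms(2) u(1)])
  finally show ?thesis .
qed

text \<open>Each vertex lies on the diagonal line it is reflected in, so both foldings fix the
  quadrilateral.\<close>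

lemma collinear_quad_periodic:
  assumes "has_sides Q a" and "coeff_0 a \<noteq> 0" and "collinear_quad Q"
  shows "periodic_disregarding_orientation n Q"
proof -
  obtain A B C D where Q: "Q = (A, B, C, D)" by (cases Q)
  have ne: "A \<noteq> C" "B \<noteq> D"
    using diag_pos_if_coeff_0_nonzero[OF assms(1,2)] by (auto simp: Q)
  have "collinear {A, B, C, D}" using assms(3) by (simp add: Q)
  hence "collinear {A, C, D}" "collinear {B, D, C}"
    by (auto elim: collinear_subset)
  hence "fold_CD Q = Some Q"
    using ne by (simp add: fold_CD_def Q reflect_line_fixed)
  hence "iterate_fold_CD n Q = Some Q"
    by (induction n) (simp_all add: iterate_fold_CD_0 iterate_fold_CD_Suc)
  moreover have "congruent_quad Q Q"
    unfolding Q congruent_quad.simps by (rule exI[of _ id]) simp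
  ultimately show ?thesis
    by (simp add: periodic_disregarding_orientation_def)
qed

text \<open>Foldings fix a collinear quadrilateral with \<open>A \<noteq> C\<close> and
  \<open>B \<noteq> D\<close>, making it \<open>n\<close>-periodic for every \<open>n\<close>. The
  pointwise equivalence therefore concerns the noncollinear ones, while the universal one ranges
  over all.\<close>

theorem theorem4:
  fixes a :: "real ^ 4" and n :: nat and S :: "complex fps"
  assumes "admissible_sides a"
    and "n \<ge> 1"
    and "sqrt_expansion a S"
  shows "(\<forall>Q. has_sides Q a \<and> \<not> collinear_quad Q \<longrightarrow>
            (periodic_disregarding_orientation n Q \<longleftrightarrow> period_condition S n)) \<and>
         ((\<forall>Q. has_sides Q a \<longrightarrow> periodic_disregarding_orientation n Q) \<longleftrightarrow>
            period_condition S n)"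
proof (cases "coeff_0 a = 0")
  case True
  note pos = admissible_sides_pos[OF assms(1)]
  have "\<not> periodic_disregarding_orientation n Q" if "has_sides Q a" for Q
    using kite_not_periodic[OF that assms(2) True] kite_if_coeff_0_eq_0[OF pos assms(3) True] by blast
  \<comment> \<open>A witness is needed so that the universal claim fails instead of holding
    vacuously.\<close>
  moreover obtain Q where "has_sides Q a"
    using noncollinear_quad_exists[OF assms(1)] by blast
  ultimately show ?thesis
    using not_period_condition_if_coeff_0_eq_0[OF assms(3,2) True] by blast
next
  case False
  have noncollinear: "periodic_disregarding_orientation n Q \<longleftrightarrow> period_condition S n"
    if "has_sides Q a" "\<not> collinear_quad Q" for Q
    using periodic_iff_period_condition[OF admissible_sides_pos[OF assms(1)] assms(2,3) False that] .
  moreover obtain Q where "has_sides Q a" "\<not> collinear_quad Q"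
    using noncollinear_quad_exists[OF assms(1)] by blast
  ultimately show ?thesis
    using collinear_quad_periodic[OF _ False] by blast
qed

end
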